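(* Let $n\ge 1$, let $A:\mathbb{R}\to\mathcal{L}(\mathbb{R}^n)$ be of locally bounded variation, and let $C\in\mathcal{L}(\mathbb{R}^n)$ be a constant matrix and $\omega>0$. Assume that: (i) $A(t+\omega)-A(t)=C$ for all $t\in\mathbb{R}$; (ii) $f:\mathbb{R}\to\mathbb{R}^n$ is regulated on every compact interval and $\omega$-periodic, i.e. $f(t+\omega)=f(t)$ for all $t\in\mathbb{R}$; (iii) the matrices $I-\Delta^{-}A(t)$ and $I+\Delta^{+}A(t)$ are invertible for all $t\in\mathbb{R}$, and the homogeneous generalized linear differential equation $\frac{dx}{d\tau}=D[A(t)x]$ admits an exponential dichotomy on $\mathbb{R}$. Then the inhomogeneous generalized linear differential equation $$\frac{dx}{d\tau}=D[A(t)x+f(t)]$$ admits a unique $\omega$-periodic solution.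
   Context: $\mathcal{L}(\mathbb{R}^n)$ is the space of real $n\times n$ matrices with the operator norm, and $I$ is the identity matrix. For a function $\Phi:[a,b]\to X$ into a Banach space, $\mathrm{var}_a^b(\Phi)$ is the supremum over partitions $a=\alpha_0<\alpha_1<\dots<\alpha_m=b$ of $\sum_{j=1}^m\|\Phi(\alpha_j)-\Phi(\alpha_{j-1})\|_X$. A function $\Phi:\mathbb{R}\to X$ is of locally bounded variation if $\mathrm{var}_a^b(\Phi)<\infty$ for every compact interval $[a,b]$. A function $\Phi:[a,b]\to X$ is regulated if the right limit $\Phi(t^+)$ exists in $X$ for every $t\in[a,b)$ and the left limit $\Phi(t^-)$ exists in $X$ for every $t\in(a,b]$; functions of bounded variation are regulated. Notation: $\Delta^{+}\Phi(t)=\Phi(t^+)-\Phi(t)$, $\Delta^{-}\Phi(t)=\Phi(t)-\Phi(t^-)$. Kurzweil--Stieltjes integral: $\int_a^b \mathrm{d}[A(s)]g(s)=\mathcal{X}$ for $g:[a,b]\to\mathbb{R}^n$ means that for every $\varepsilon>0$ there is a function $\delta:[a,b]\to(0,\infty)$ such that $\big\|\sum_{j=1}^m[A(\alpha_j)-A(\alpha_{j-1})]g(\tau_j)-\mathcal{X}\big\|<\varepsilon$ for every partition $a=\alpha_0<\dots<\alpha_m=b$ with tags $\tau_j\in[\alpha_{j-1},\alpha_j]$ satisfying $[\alpha_{j-1},\alpha_j]\subset(\tau_j-\delta(\tau_j),\tau_j+\delta(\tau_j))$ for all $j$. Also $\int_b^a=-\int_a^b$ and $\int_c^c=0$. For matrix-valued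 integrands the integral is taken column by column. A solution on $\mathbb{R}$ of $\frac{dx}{d\tau}=D[A(t)x+f(t)]$ is a function $x:\mathbb{R}\to\mathbb{R}^n$ such that $x(t)=x(s)+\int_s^t\mathrm{d}[A(r)]x(r)+f(t)-f(s)$ for all $s,t\in\mathbb{R}$ (the integrals existing); the homogeneous equation $\frac{dx}{d\tau}=D[A(t)x]$ is the case $f=0$. A solution is $\omega$-periodic if $x(t+\omega)=x(t)$ for all $t\in\mathbb{R}$. Under the stated invertibility and variation hypotheses on $A$, there is a unique matrix function $U:\mathbb{R}\times\mathbb{R}\to\mathcal{L}(\mathbb{R}^n)$, the transition matrix of the homogeneous equation, with $U(t,s)=I+\int_s^t\mathrm{d}[A(r)]U(r,s)$ for all $t,s\in\mathbb{R}$; each $U(t,s)$ is invertible. Set $\mathcal{U}(t)=U(t,0)$. The homogeneous equation admits an exponential dichotomy on $\mathbb{R}$ if there exist constants $K,\alpha>0$ and a projection (linear map with $P^2=P$) $P:\mathbb{R}^n\to\mathbb{R}^n$ such that $\|\mathcal{U}(t)P\mathcal{U}^{-1}(s)\|\le Ke^{-\alpha(t-s)}$ for all $t\ge s$, and $\|\mathcal{U}(t)(I-P)\mathcal{U}^{-1}(s)\|\le Ke^{-\alpha(s-t)}$ for all $s\ge t$, where $\mathcal{U}^{-1}(s)=[\mathcal{U}(s)]^{-1}$. *)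

theory Defs
  imports "HOL-Analysis.Analysis"
begin

text \<open>
  The type class norm on \<^typ>\<open>real^'n^'n\<close> is the Euclidean norm of the entries, so the
  operator norm is introduced separately; limits are unaffected by this choice.
\<close>
definition op_norm :: "real^'n^'n \<Rightarrow> real" where
  "op_norm M = onorm (\<lambda>v. M *v v)"

definition is_partition :: "real \<Rightarrow> real \<Rightarrow> nat \<Rightarrow> (nat \<Rightarrow> real) \<Rightarrow> bool" where
  "is_partition a b m \<alpha> \<longleftrightarrow> \<alpha> 0 = a \<and> \<alpha> m = b \<and> (\<forall>j<m. \<alpha> j < \<alpha> (Suc j))"

definition variation :: "real \<Rightarrow> real \<Rightarrow> (real \<Rightarrow> real^'n^'n) \<Rightarrow> ereal" where
  "variation a b \<Phi> =
     (SUP (m, \<alpha>) \<in> {(m, \<alpha>). is_partition a b m \<alpha>}.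
        ereal (\<Sum>j<m. op_norm (\<Phi> (\<alpha> (Suc j)) - \<Phi> (\<alpha> j))))"

definition locally_bounded_variation :: "(real \<Rightarrow> real^'n^'n) \<Rightarrow> bool" where
  "locally_bounded_variation \<Phi> \<longleftrightarrow> (\<forall>a b. a \<le> b \<longrightarrow> variation a b \<Phi> < \<infinity>)"

definition regulated_on :: "real \<Rightarrow> real \<Rightarrow> (real \<Rightarrow> 'a::topological_space) \<Rightarrow> bool" where
  "regulated_on a b \<Phi> \<longleftrightarrow>
     (\<forall>t\<in>{a..<b}. \<exists>l. (\<Phi> \<longlongrightarrow> l) (at_right t)) \<and>
     (\<forall>t\<in>{a<..b}. \<exists>l. (\<Phi> \<longlongrightarrow> l) (at_left t))"

definition right_jump :: "(real \<Rightarrow> 'a::real_normed_vector) \<Rightarrow> real \<Rightarrow> 'a" where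
  "right_jump \<Phi> t = Lim (at_right t) \<Phi> - \<Phi> t"

definition left_jump :: "(real \<Rightarrow> 'a::real_normed_vector) \<Rightarrow> real \<Rightarrow> 'a" where
  "left_jump \<Phi> t = \<Phi> t - Lim (at_left t) \<Phi>"

text \<open>The Kurzweil--Stieltjes integral of \<open>d[A(s)] g(s)\<close> over \<open>[a, b]\<close>, meant for \<open>a < b\<close>.\<close>
definition has_ks_integral_pos ::
  "(real \<Rightarrow> real^'n^'n) \<Rightarrow> (real \<Rightarrow> real^'n) \<Rightarrow> real \<Rightarrow> real \<Rightarrow> real^'n \<Rightarrow> bool" where
  "has_ks_integral_pos A g a b X \<longleftrightarrow>
     (\<forall>\<epsilon>>0. \<exists>\<delta>. (\<forall>t\<in>{a..b}. \<delta> t > 0) \<and>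
        (\<forall>m \<alpha> \<tau>. is_partition a b m \<alpha> \<and>
           (\<forall>j<m. \<tau> j \<in> {\<alpha> j..\<alpha> (Suc j)} \<and>
                  {\<alpha> j..\<alpha> (Suc j)} \<subseteq> {\<tau> j - \<delta> (\<tau> j)<..<\<tau> j + \<delta> (\<tau> j)}) \<longrightarrow>
           norm ((\<Sum>j<m. (A (\<alpha> (Suc j)) - A (\<alpha> j)) *v g (\<tau> j)) - X) < \<epsilon>))"

definition has_ks_integral ::
  "(real \<Rightarrow> real^'n^'n) \<Rightarrow> (real \<Rightarrow> real^'n) \<Rightarrow> real \<Rightarrow> real \<Rightarrow> real^'n \<Rightarrow> bool" where
  "has_ks_integral A g a b X \<longleftrightarrow>
     (if a < b then has_ks_integral_pos A g a b X
      else if b < a then has_ks_integral_pos A g b a (- X)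
      else X = 0)"

definition has_ks_integral_matrix ::
  "(real \<Rightarrow> real^'n^'n) \<Rightarrow> (real \<Rightarrow> real^'n^'n) \<Rightarrow> real \<Rightarrow> real \<Rightarrow> real^'n^'n \<Rightarrow> bool" where
  "has_ks_integral_matrix A G a b X \<longleftrightarrow>
     (\<forall>j. has_ks_integral A (\<lambda>r. column j (G r)) a b (column j X))"

definition glde_solution ::
  "(real \<Rightarrow> real^'n^'n) \<Rightarrow> (real \<Rightarrow> real^'n) \<Rightarrow> (real \<Rightarrow> real^'n) \<Rightarrow> bool" where
  "glde_solution A f x \<longleftrightarrow>
     (\<forall>s t. \<exists>X. has_ks_integral A x s t X \<and> x t = x s + X + f t - f s)"

definition is_transition_matrix ::
  "(real \<Rightarrow> real^'n^'n) \<Rightarrow> (real \<Rightarrow> real \<Rightarrow> real^'n^'n) \<Rightarrow> bool" where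
  "is_transition_matrix A U \<longleftrightarrow>
     (\<forall>t s. \<exists>X. has_ks_integral_matrix A (\<lambda>r. U r s) s t X \<and> U t s = mat 1 + X)"

text \<open>
  The transition matrix exists uniquely when \<open>A\<close> is of locally bounded variation and all
  \<open>I - \<Delta>\<^sup>-A(t)\<close>, \<open>I + \<Delta>\<^sup>+A(t)\<close> are invertible; outside that setting the value is unspecified.
\<close>
definition transition_matrix :: "(real \<Rightarrow> real^'n^'n) \<Rightarrow> real \<Rightarrow> real \<Rightarrow> real^'n^'n" where
  "transition_matrix A = (THE U. is_transition_matrix A U)"

definition fundamental_matrix :: "(real \<Rightarrow> real^'n^'n) \<Rightarrow> real \<Rightarrow> real^'n^'n" where
  "fundamental_matrix A t = transition_matrix A t 0"

definition exponential_dichotomy :: "(real \<Rightarrow> real^'n^'n) \<Rightarrow> bool" where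
  "exponential_dichotomy A \<longleftrightarrow>
     (\<exists>K \<alpha> P. K > 0 \<and> \<alpha> > 0 \<and> P ** P = P \<and>
        (\<forall>t s. s \<le> t \<longrightarrow>
           op_norm (fundamental_matrix A t ** P ** matrix_inv (fundamental_matrix A s))
             \<le> K * exp (- \<alpha> * (t - s))) \<and>
        (\<forall>t s. t \<le> s \<longrightarrow>
           op_norm (fundamental_matrix A t ** (mat 1 - P) ** matrix_inv (fundamental_matrix A s))
             \<le> K * exp (- \<alpha> * (s - t))))"

end

theory Submission
  imports Defs
begin

text \<open>
  If the monodromy matrix \<open>U(\<omega>, 0)\<close> fixes a vector \<open>v\<close>, then \<open>U(t, 0) v\<close> is a periodic solution of the
  homogeneous equation, so \<open>v = U(0, \<plusminus>k\<omega>) v\<close> for all \<open>k\<close>, and the dichotomy estimates force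
  \<open>v = 0\<close>. Hence \<open>I - U(\<omega>, 0)\<close> is invertible, and exactly one initial value makes the solution of the
  inhomogeneous equation return to it after time \<open>\<omega>\<close>; since \<open>A\<close> has periodic increments and \<open>f\<close> is
  periodic, that solution is periodic.

  Initial value problems are solved by a Neumann series on intervals where \<open>A\<close> has variation at most
  \<open>1/2\<close>. Every point has one-sided neighbourhoods of this kind once the jump at the point itself has
  been split off, and the invertibility assumptions allow solving across the jump.
\<close>

section \<open>Kurzweil integrals of interval functions over tagged chains\<close>

text \<open>A function \<open>x\<close> solves the equation iff \<open>x - f\<close> is a primitive
  of the interval function \<open>stieltjes A x\<close>. In this form linear combinations, gluing,
  translation by \<omega> and time reversal of solutions are operations on primitives. Time reversal
  also exchanges the two invertibility hypotheses, so the local analysis of integrals and solutions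
  is carried out to the right of a point and reflected.

  The obstacle is that no integral is available beforehand: existence for regulated integrands,
  passage to uniform limits and the behaviour of a primitive at an endpoint all have to come from
  gauges. Bounded variation enters only through a scalar function \<open>V\<close> whose increments
  dominate those of \<open>A\<close>; its monotonicity yields one-sided limits as well as estimates.
  The bound 1/2 makes integration against \<open>A\<close> halve the sup norm, which gives a
  geometric series for existence and an iterated halving for uniqueness.

  The dichotomy is evaluated only at time 0 on one side, where the fundamental matrix is the
  identity: the two estimates then bound \<open>P v\<close> and \<open>(I - P) v\<close>
  separately.\<close>

text \<open>
  A list entry \<open>(t, c)\<close> stands for the interval with tag \<open>t\<close> that ends at \<open>c\<close> and begins where the
  previous interval ends; interval functions \<open>F t u v\<close> take the tag first.
\<close>
fun fine_chain :: "(real \<Rightarrow> real) \<Rightarrow> real \<Rightarrow> real \<Rightarrow> (real \<times> real) list \<Rightarrow> bool" where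
  "fine_chain \<delta> a b [] \<longleftrightarrow> a = b"
| "fine_chain \<delta> a b ((t, c) # ps) \<longleftrightarrow>
     a < c \<and> a \<le> t \<and> t \<le> c \<and> t - \<delta> t < a \<and> c < t + \<delta> t \<and> fine_chain \<delta> c b ps"

fun chain_sum :: "(real \<Rightarrow> real \<Rightarrow> real \<Rightarrow> 'a::real_normed_vector) \<Rightarrow> real \<Rightarrow> (real \<times> real) list \<Rightarrow> 'a" where
  "chain_sum F a [] = 0"
| "chain_sum F a ((t, c) # ps) = F t a c + chain_sum F c ps"

text \<open>The gauge is positive on the whole line, which lets gauges be combined and transported
  without tracking intervals; its values outside the interval do not affect fineness. For
  \<open>b < a\<close> there is no chain and every \<open>X\<close> qualifies, so uniqueness is
  claimed only for \<open>a \<le> b\<close>.\<close>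

definition has_kint :: "(real \<Rightarrow> real \<Rightarrow> real \<Rightarrow> 'a::real_normed_vector) \<Rightarrow> real \<Rightarrow> real \<Rightarrow> 'a \<Rightarrow> bool" where
  "has_kint F a b X \<longleftrightarrow> (\<forall>\<epsilon>>0. \<exists>\<delta>. (\<forall>t. \<delta> t > 0) \<and>
     (\<forall>ps. fine_chain \<delta> a b ps \<longrightarrow> norm (chain_sum F a ps - X) \<le> \<epsilon>))"

text \<open>An indefinite integral given by its increments, hence fixed on \<open>S\<close> only up
  to a constant. Normalisation at a base point is a separate step.\<close>

definition kprim :: "(real \<Rightarrow> real \<Rightarrow> real \<Rightarrow> 'a::real_normed_vector) \<Rightarrow> real set \<Rightarrow> (real \<Rightarrow> 'a) \<Rightarrow> bool" where
  "kprim F S K \<longleftrightarrow> (\<forall>s\<in>S. \<forall>t\<in>S. s \<le> t \<longrightarrow> has_kint F s t (K t - K s))"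

section \<open>Fine chains and their existence\<close>

lemma fine_chain_le: "fine_chain \<delta> a b ps \<Longrightarrow> a \<le> b"
  by (induction ps arbitrary: a) fastforce+

lemma fine_chain_mono_on:
  "fine_chain \<delta> a b ps \<Longrightarrow> (\<And>t. a \<le> t \<Longrightarrow> t \<le> b \<Longrightarrow> \<delta> t \<le> \<delta>' t) \<Longrightarrow> fine_chain \<delta>' a b ps"
proof (induction ps arbitrary: a)
  case (Cons p ps)
  obtain t c where p: "p = (t, c)" by force
  have c: "fine_chain \<delta> c b ps" and ac: "a < c" "a \<le> t" "t \<le> c" using Cons.prems(1) p by auto
  have "c \<le> b" using fine_chain_le[OF c] .
  then have "\<delta> t \<le> \<delta>' t" using Cons.prems(2) ac by simp
  moreover have "fine_chain \<delta>' c b ps"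
    by (rule Cons.IH[OF c]) (rule Cons.prems(2), use ac in simp_all)
  ultimately show ?case using Cons.prems(1) p by simp
qed simp

lemma fine_chain_mono:
  "fine_chain \<delta> a b ps \<Longrightarrow> (\<And>t. \<delta> t \<le> \<delta>' t) \<Longrightarrow> fine_chain \<delta>' a b ps"
  by (rule fine_chain_mono_on)

lemma fine_chain_append:
  "fine_chain \<delta> a b ps \<Longrightarrow> fine_chain \<delta> b c qs \<Longrightarrow> fine_chain \<delta> a c (ps @ qs)"
  by (induction ps arbitrary: a) auto

lemma chain_sum_append:
  "fine_chain \<delta> a b ps \<Longrightarrow> chain_sum F a (ps @ qs) = chain_sum F a ps + chain_sum F b qs"
  by (induction ps arbitrary: a) (auto simp: add.assoc)

text \<open>Cousin's lemma. An interval around \<open>x\<close> shorter than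
  \<open>\<delta> x\<close> is fine with the single tag \<open>x\<close>, and fine chains can be
  concatenated, so bisection carries existence to the whole interval.\<close>

lemma fine_chain_exists:
  assumes "a \<le> b" "\<And>t. \<delta> t > 0"
  shows "\<exists>ps. fine_chain \<delta> a b ps"
proof (rule Bolzano[OF assms(1), of "\<lambda>u v. \<exists>ps. fine_chain \<delta> u v ps"])
  fix x
  have "\<exists>ps. fine_chain \<delta> u v ps" if "u \<le> x" "x \<le> v" "v - u < \<delta> x" for u v
  proof (cases "u = v")
    case True
    then show ?thesis by (intro exI[of _ "[]"]) auto
  next
    case False
    then show ?thesis using that by (intro exI[of _ "[(x, v)]"]) auto
  qed
  then show "\<exists>d>0. \<forall>u v. u \<le> x \<and> x \<le> v \<and> v - u < d \<longrightarrow> (\<exists>ps. fine_chain \<delta> u v ps)"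
    using assms(2) by blast
qed (use fine_chain_append in blast)

section \<open>Uniqueness, linearity and limits of the integral\<close>

lemma has_kint_iff_less:
  "has_kint F a b X \<longleftrightarrow> (\<forall>\<epsilon>>0. \<exists>\<delta>. (\<forall>t. \<delta> t > 0) \<and>
     (\<forall>ps. fine_chain \<delta> a b ps \<longrightarrow> norm (chain_sum F a ps - X) < \<epsilon>))"
  (is "_ = ?R")
proof
  assume H: "has_kint F a b X"
  show ?R
  proof (intro allI impI)
    fix \<epsilon> :: real
    assume "\<epsilon> > 0"
    then have "\<epsilon> / 2 > 0" by simp
    then obtain \<delta> where "\<forall>t. \<delta> t > 0"
      and d: "\<forall>ps. fine_chain \<delta> a b ps \<longrightarrow> norm (chain_sum F a ps - X) \<le> \<epsilon> / 2"
      using H unfolding has_kint_def by blast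
    moreover have "\<forall>ps. fine_chain \<delta> a b ps \<longrightarrow> norm (chain_sum F a ps - X) < \<epsilon>"
      using d \<open>\<epsilon> > 0\<close> by fastforce
    ultimately show "\<exists>\<delta>. (\<forall>t. \<delta> t > 0) \<and>
        (\<forall>ps. fine_chain \<delta> a b ps \<longrightarrow> norm (chain_sum F a ps - X) < \<epsilon>)"
      by blast
  qed
next
  assume H: ?R
  show "has_kint F a b X"
    unfolding has_kint_def
  proof (intro allI impI)
    fix \<epsilon> :: real
    assume "\<epsilon> > 0"
    then obtain \<delta> where "\<forall>t. \<delta> t > 0"
      "\<forall>ps. fine_chain \<delta> a b ps \<longrightarrow> norm (chain_sum F a ps - X) < \<epsilon>"
      using H by blast
    then show "\<exists>\<delta>. (\<forall>t. \<delta> t > 0) \<and>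
        (\<forall>ps. fine_chain \<delta> a b ps \<longrightarrow> norm (chain_sum F a ps - X) \<le> \<epsilon>)"
      using less_imp_le by blast
  qed
qed

lemma has_kintE:
  assumes "has_kint F a b X" "\<epsilon> > 0"
  obtains \<delta> where "\<And>t. \<delta> t > 0"
    "\<And>ps. fine_chain \<delta> a b ps \<Longrightarrow> norm (chain_sum F a ps - X) \<le> \<epsilon>"
  using assms unfolding has_kint_def by blast

text \<open>One chain that is fine for both gauges compares the two values; Cousin's lemma provides
  it because \<open>a \<le> b\<close>.\<close>

lemma has_kint_unique:
  assumes "has_kint F a b X" "has_kint F a b Y" "a \<le> b"
  shows "X = Y"
proof -
  have "norm (X - Y) \<le> \<epsilon>" if "\<epsilon> > 0" for \<epsilon>
  proof -
    have e: "\<epsilon> / 2 > 0" using that by simp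
    obtain d1 where d1: "\<And>t. d1 t > 0"
      "\<And>ps. fine_chain d1 a b ps \<Longrightarrow> norm (chain_sum F a ps - X) \<le> \<epsilon> / 2"
      using has_kintE[OF assms(1) e] by blast
    obtain d2 where d2: "\<And>t. d2 t > 0"
      "\<And>ps. fine_chain d2 a b ps \<Longrightarrow> norm (chain_sum F a ps - Y) \<le> \<epsilon> / 2"
      using has_kintE[OF assms(2) e] by blast
    obtain ps where ps: "fine_chain (\<lambda>t. min (d1 t) (d2 t)) a b ps"
      using fine_chain_exists[OF assms(3), of "\<lambda>t. min (d1 t) (d2 t)"] d1(1) d2(1) by auto
    have "norm (chain_sum F a ps - X) \<le> \<epsilon> / 2" "norm (chain_sum F a ps - Y) \<le> \<epsilon> / 2"
      using fine_chain_mono[OF ps, of d1] fine_chain_mono[OF ps, of d2] d1(2) d2(2) by auto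
    then show ?thesis
      using norm_triangle_ineq4[of "chain_sum F a ps - Y" "chain_sum F a ps - X"] by simp
  qed
  then have "norm (X - Y) \<le> 0" by (meson dense not_le)
  then show ?thesis by simp
qed

lemma has_kint_refl: "has_kint F a a X \<longleftrightarrow> X = 0"
proof -
  have nil: "chain_sum F a ps = 0" if "fine_chain \<delta> a a ps" for \<delta> ps
    using that fine_chain_le by (cases ps) fastforce+
  have "has_kint F a a 0"
    unfolding has_kint_def using nil by (auto intro!: exI[of _ "\<lambda>_. 1"])
  then show ?thesis using has_kint_unique by blast
qed

lemma chain_sum_cong:
  assumes "fine_chain \<delta> a b ps"
    and "\<And>t u v. a \<le> u \<Longrightarrow> u \<le> t \<Longrightarrow> t \<le> v \<Longrightarrow> v \<le> b \<Longrightarrow> u < v \<Longrightarrow> F t u v = G t u v"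
  shows "chain_sum F a ps = chain_sum G a ps"
  using assms
proof (induction ps arbitrary: a)
  case (Cons p ps)
  obtain t c where p: "p = (t, c)" by force
  then have c: "fine_chain \<delta> c b ps" and "a < c" "a \<le> t" "t \<le> c" using Cons.prems by auto
  then have "c \<le> b" using fine_chain_le by blast
  then have "F t a c = G t a c" using Cons.prems(2) \<open>a < c\<close> \<open>a \<le> t\<close> \<open>t \<le> c\<close> by blast
  moreover have "chain_sum F c ps = chain_sum G c ps"
    by (rule Cons.IH[OF c]) (rule Cons.prems(2), use \<open>a < c\<close> in simp_all)
  ultimately show ?case using p by simp
qed simp

lemma has_kint_cong:
  assumes "has_kint F a b X"
    and "\<And>t u v. a \<le> u \<Longrightarrow> u \<le> t \<Longrightarrow> t \<le> v \<Longrightarrow> v \<le> b \<Longrightarrow> u < v \<Longrightarrow> F t u v = G t u v"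
  shows "has_kint G a b X"
proof -
  have "chain_sum F a ps = chain_sum G a ps" if "fine_chain \<delta> a b ps" for \<delta> ps
    using chain_sum_cong[OF that] assms(2) by blast
  then show ?thesis using assms(1) unfolding has_kint_def by auto
qed

lemma chain_sum_add:
  "chain_sum (\<lambda>t u v. F t u v + G t u v) a ps = chain_sum F a ps + chain_sum G a ps"
  by (induction ps arbitrary: a) (auto simp: algebra_simps)

lemma chain_sum_linear:
  assumes "linear h"
  shows "chain_sum (\<lambda>t u v. h (F t u v)) a ps = h (chain_sum F a ps)"
  by (induction ps arbitrary: a) (auto simp: linear_add[OF assms] linear_0[OF assms])

lemma has_kint_linear:
  assumes "bounded_linear h" "has_kint F a b X"
  shows "has_kint (\<lambda>t u v. h (F t u v)) a b (h X)"
  unfolding has_kint_def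
proof (intro allI impI)
  interpret bounded_linear h by fact
  fix \<epsilon> :: real
  assume "\<epsilon> > 0"
  obtain B where B: "B > 0" "\<And>x. norm (h x) \<le> norm x * B"
    using pos_bounded by blast
  then have "\<epsilon> / B > 0" using \<open>\<epsilon> > 0\<close> by simp
  then obtain \<delta> where d: "\<And>t. \<delta> t > 0"
    "\<And>ps. fine_chain \<delta> a b ps \<Longrightarrow> norm (chain_sum F a ps - X) \<le> \<epsilon> / B"
    using has_kintE[OF assms(2)] by blast
  have "norm (chain_sum (\<lambda>t u v. h (F t u v)) a ps - h X) \<le> \<epsilon>" if "fine_chain \<delta> a b ps" for ps
  proof -
    have "chain_sum (\<lambda>t u v. h (F t u v)) a ps - h X = h (chain_sum F a ps - X)"
      by (simp add: chain_sum_linear linear_axioms diff)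
    also have "norm \<dots> \<le> norm (chain_sum F a ps - X) * B" by (rule B)
    also have "\<dots> \<le> \<epsilon>" using d(2)[OF that] B(1) by (simp add: field_simps)
    finally show ?thesis .
  qed
  then show "\<exists>\<delta>. (\<forall>t. \<delta> t > 0) \<and> (\<forall>ps. fine_chain \<delta> a b ps \<longrightarrow>
      norm (chain_sum (\<lambda>t u v. h (F t u v)) a ps - h X) \<le> \<epsilon>)"
    using d(1) by blast
qed

text \<open>The estimate by \<open>e n\<close> holds along every chain, whatever its gauge.
  Therefore the gauge belonging to one sufficiently large \<open>n\<close> already serves the
  limit.\<close>

lemma has_kint_limit:
  assumes F: "\<And>n. has_kint (F n) a b (X n)"
    and le: "\<And>n \<delta> ps. fine_chain \<delta> a b ps \<Longrightarrow> norm (chain_sum (F n) a ps - chain_sum G a ps) \<le> e n"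
    and e: "e \<longlonglongrightarrow> 0" and X: "X \<longlonglongrightarrow> Y"
  shows "has_kint G a b Y"
  unfolding has_kint_def
proof (intro allI impI)
  fix \<epsilon> :: real
  assume "\<epsilon> > 0"
  then have e3: "\<epsilon> / 3 > 0" by simp
  have "\<forall>\<^sub>F n in sequentially. e n < \<epsilon> / 3 \<and> dist (X n) Y < \<epsilon> / 3"
    using order_tendstoD(2)[OF e e3] tendstoD[OF X e3] by (rule eventually_conj)
  then obtain n where n: "e n < \<epsilon> / 3" "dist (X n) Y < \<epsilon> / 3"
    by (auto simp: eventually_sequentially)
  obtain \<delta> where d: "\<And>t. \<delta> t > 0"
    "\<And>ps. fine_chain \<delta> a b ps \<Longrightarrow> norm (chain_sum (F n) a ps - X n) \<le> \<epsilon> / 3"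
    using has_kintE[OF F e3] by blast
  have "norm (chain_sum G a ps - Y) \<le> \<epsilon>" if "fine_chain \<delta> a b ps" for ps
  proof -
    have "chain_sum G a ps - Y = (chain_sum (F n) a ps - X n) + (X n - Y)
        - (chain_sum (F n) a ps - chain_sum G a ps)" by simp
    also have "norm \<dots> \<le> norm (chain_sum (F n) a ps - X n) + norm (X n - Y)
        + norm (chain_sum (F n) a ps - chain_sum G a ps)"
      by (meson add_mono norm_triangle_ineq norm_triangle_ineq4 order.refl order_trans)
    also have "\<dots> \<le> \<epsilon>"
      using d(2)[OF that] n le[OF that, of n] by (simp add: dist_norm)
    finally show ?thesis .
  qed
  then show "\<exists>\<delta>. (\<forall>t. \<delta> t > 0) \<and>
      (\<forall>ps. fine_chain \<delta> a b ps \<longrightarrow> norm (chain_sum G a ps - Y) \<le> \<epsilon>)"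
    using d(1) by blast
qed

lemma has_kint_add:
  assumes "has_kint F a b X" "has_kint G a b Y"
  shows "has_kint (\<lambda>t u v. F t u v + G t u v) a b (X + Y)"
  unfolding has_kint_def
proof (intro allI impI)
  fix \<epsilon> :: real
  assume "\<epsilon> > 0"
  then have e: "\<epsilon> / 2 > 0" by simp
  obtain d1 where d1: "\<And>t. d1 t > 0"
    "\<And>ps. fine_chain d1 a b ps \<Longrightarrow> norm (chain_sum F a ps - X) \<le> \<epsilon> / 2"
    using has_kintE[OF assms(1) e] by blast
  obtain d2 where d2: "\<And>t. d2 t > 0"
    "\<And>ps. fine_chain d2 a b ps \<Longrightarrow> norm (chain_sum G a ps - Y) \<le> \<epsilon> / 2"
    using has_kintE[OF assms(2) e] by blast
  show "\<exists>\<delta>. (\<forall>t. \<delta> t > 0) \<and> (\<forall>ps. fine_chain \<delta> a b ps \<longrightarrow>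
      norm (chain_sum (\<lambda>t u v. F t u v + G t u v) a ps - (X + Y)) \<le> \<epsilon>)"
  proof (intro exI[of _ "\<lambda>t. min (d1 t) (d2 t)"] conjI allI impI)
    fix ps
    assume ps: "fine_chain (\<lambda>t. min (d1 t) (d2 t)) a b ps"
    have "norm (chain_sum F a ps - X) \<le> \<epsilon> / 2" "norm (chain_sum G a ps - Y) \<le> \<epsilon> / 2"
      using fine_chain_mono[OF ps, of d1] fine_chain_mono[OF ps, of d2] d1(2) d2(2) by auto
    then show "norm (chain_sum (\<lambda>t u v. F t u v + G t u v) a ps - (X + Y)) \<le> \<epsilon>"
      using norm_triangle_ineq[of "chain_sum F a ps - X" "chain_sum G a ps - Y"]
      by (simp add: chain_sum_add algebra_simps)
  qed (use d1(1) d2(1) in auto)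
qed

text \<open>The bound on \<open>\<delta>\<close> forces the interval that contains \<open>b\<close> to have the tag \<open>b\<close>.\<close>
lemma fine_chain_split:
  assumes "fine_chain \<delta> a c ps" "a \<le> b" "b \<le> c"
    and "\<And>t. t \<noteq> b \<Longrightarrow> \<delta> t \<le> \<bar>t - b\<bar>"
    and "\<And>u v. u \<le> b \<Longrightarrow> b \<le> v \<Longrightarrow> F b u v = F b u b + F b b v" "F b b b = 0"
  shows "\<exists>qs rs. fine_chain \<delta> a b qs \<and> fine_chain \<delta> b c rs \<and>
    chain_sum F a ps = chain_sum F a qs + chain_sum F b rs"
  using assms(1,2)
proof (induction ps arbitrary: a)
  case Nil
  then have "a = b" "c = b" using assms(3) by auto
  then show ?case by (intro exI[of _ "[]"]) auto
next
  case (Cons p ps)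
  obtain t e where p: "p = (t, e)" by force
  have e: "a < e" "a \<le> t" "t \<le> e" "t - \<delta> t < a" "e < t + \<delta> t" "fine_chain \<delta> e c ps"
    using Cons.prems p by auto
  show ?case
  proof (cases "e \<le> b")
    case True
    then obtain qs rs where "fine_chain \<delta> e b qs" "fine_chain \<delta> b c rs"
      "chain_sum F e ps = chain_sum F e qs + chain_sum F b rs"
      using Cons.IH[OF e(6)] by blast
    then show ?thesis using e p
      by (intro exI[of _ "(t, e) # qs"] exI[of _ rs]) auto
  next
    case False
    have t: "t = b"
    proof (rule ccontr)
      assume "t \<noteq> b"
      then have "\<delta> t \<le> \<bar>t - b\<bar>" using assms(4) by blast
      then show False using e False Cons.prems(2) by linarith
    qed
    \<comment> \<open>The interval that crosses \<open>b\<close> is cut there, and both halves keep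
      the tag \<open>b\<close>.\<close>
    have r: "fine_chain \<delta> b c ((b, e) # ps)" using e t False by auto
    have s: "F b a e = F b a b + F b b e" by (rule assms(5)) (use Cons.prems(2) False in auto)
    show ?thesis
    proof (cases "a = b")
      case True
      then show ?thesis using r p t by (intro exI[of _ "[]"] exI[of _ "(b, e) # ps"]) auto
    next
      case ne: False
      then show ?thesis using r p t e s Cons.prems(2)
        by (intro exI[of _ "[(b, b)]"] exI[of _ "(b, e) # ps"]) auto
    qed
  qed
qed

text \<open>The errors \<open>e1\<close> and \<open>e2\<close> are fixed numbers, so that the same
  argument serves additivity of the integral and additivity of approximate integrability.\<close>

lemma has_kint_approx_combine:
  assumes 1: "\<And>t. d1 t > 0" "\<And>ps. fine_chain d1 a b ps \<Longrightarrow> norm (chain_sum F a ps - X) \<le> e1"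
    and 2: "\<And>t. d2 t > 0" "\<And>ps. fine_chain d2 b c ps \<Longrightarrow> norm (chain_sum F b ps - Y) \<le> e2"
    and F: "\<And>u v. u \<le> b \<Longrightarrow> b \<le> v \<Longrightarrow> F b u v = F b u b + F b b v" "F b b b = 0"
    and "a \<le> b" "b \<le> c"
  shows "\<exists>\<delta>. (\<forall>t. \<delta> t > 0) \<and>
    (\<forall>ps. fine_chain \<delta> a c ps \<longrightarrow> norm (chain_sum F a ps - (X + Y)) \<le> e1 + e2)"
proof -
  \<comment> \<open>Away from \<open>b\<close> the gauge is capped by the distance to
    \<open>b\<close>, which is the condition for splitting chains at \<open>b\<close>.\<close>
  define \<delta> where "\<delta> t = (let m = min (d1 t) (d2 t) in if t = b then m else min m \<bar>t - b\<bar>)" for t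
  have \<delta>: "\<delta> t > 0" "\<delta> t \<le> d1 t" "\<delta> t \<le> d2 t" "t \<noteq> b \<Longrightarrow> \<delta> t \<le> \<bar>t - b\<bar>" for t
    using 1(1)[of t] 2(1)[of t] by (auto simp: \<delta>_def Let_def)
  have "norm (chain_sum F a ps - (X + Y)) \<le> e1 + e2" if ps: "fine_chain \<delta> a c ps" for ps
  proof -
    obtain qs rs where q: "fine_chain \<delta> a b qs" "fine_chain \<delta> b c rs"
      "chain_sum F a ps = chain_sum F a qs + chain_sum F b rs"
      using fine_chain_split[where F=F, OF ps \<open>a \<le> b\<close> \<open>b \<le> c\<close> \<delta>(4) F(1) F(2)] by metis
    have "norm (chain_sum F a qs - X) \<le> e1" "norm (chain_sum F b rs - Y) \<le> e2"
      using fine_chain_mono[OF q(1), of d1] fine_chain_mono[OF q(2), of d2] \<delta>(2,3) 1(2) 2(2) by auto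
    then show ?thesis
      using norm_triangle_ineq[of "chain_sum F a qs - X" "chain_sum F b rs - Y"] q(3)
      by (simp add: algebra_simps)
  qed
  then show ?thesis using \<delta>(1) by blast
qed

lemma has_kint_combine:
  assumes "has_kint F a b X" "has_kint F b c Y" "a \<le> b" "b \<le> c"
    and F: "\<And>u v. u \<le> b \<Longrightarrow> b \<le> v \<Longrightarrow> F b u v = F b u b + F b b v" "F b b b = 0"
  shows "has_kint F a c (X + Y)"
  unfolding has_kint_def
proof (intro allI impI)
  fix \<epsilon> :: real
  assume "\<epsilon> > 0"
  then have e: "\<epsilon> / 2 > 0" by simp
  obtain d1 where d1: "\<And>t. d1 t > 0"
    "\<And>ps. fine_chain d1 a b ps \<Longrightarrow> norm (chain_sum F a ps - X) \<le> \<epsilon> / 2"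
    using has_kintE[OF assms(1) e] by blast
  obtain d2 where d2: "\<And>t. d2 t > 0"
    "\<And>ps. fine_chain d2 b c ps \<Longrightarrow> norm (chain_sum F b ps - Y) \<le> \<epsilon> / 2"
    using has_kintE[OF assms(2) e] by blast
  show "\<exists>\<delta>. (\<forall>t. \<delta> t > 0) \<and> (\<forall>ps. fine_chain \<delta> a c ps \<longrightarrow> norm (chain_sum F a ps - (X + Y)) \<le> \<epsilon>)"
    using has_kint_approx_combine[of d1 a b F X _ d2 c Y, OF d1 d2 F assms(3,4)] by simp
qed

text \<open>Prepending one fixed fine chain of the left interval turns fine chains of the right
  interval into fine chains of the whole; subtracting the two approximations leaves the right
  part.\<close>

lemma has_kint_diff_right:
  assumes "has_kint F a b X" "has_kint F a c Y" "a \<le> b"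
  shows "has_kint F b c (Y - X)"
  unfolding has_kint_def
proof (intro allI impI)
  fix \<epsilon> :: real
  assume "\<epsilon> > 0"
  then have e: "\<epsilon> / 2 > 0" by simp
  obtain d1 where d1: "\<And>t. d1 t > 0"
    "\<And>ps. fine_chain d1 a b ps \<Longrightarrow> norm (chain_sum F a ps - X) \<le> \<epsilon> / 2"
    using has_kintE[OF assms(1) e] by blast
  obtain d2 where d2: "\<And>t. d2 t > 0"
    "\<And>ps. fine_chain d2 a c ps \<Longrightarrow> norm (chain_sum F a ps - Y) \<le> \<epsilon> / 2"
    using has_kintE[OF assms(2) e] by blast
  let ?d = "\<lambda>t. min (d1 t) (d2 t)"
  obtain ps where ps: "fine_chain ?d a b ps"
    using fine_chain_exists[OF assms(3), of ?d] d1(1) d2(1) by auto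
  have "norm (chain_sum F b qs - (Y - X)) \<le> \<epsilon>" if qs: "fine_chain ?d b c qs" for qs
  proof -
    have "norm (chain_sum F a ps - X) \<le> \<epsilon> / 2"
      using fine_chain_mono[OF ps, of d1] d1(2) by auto
    moreover have "norm (chain_sum F a (ps @ qs) - Y) \<le> \<epsilon> / 2"
      using fine_chain_mono[OF fine_chain_append[OF ps qs], of d2] d2(2) by auto
    ultimately show ?thesis
      using norm_triangle_ineq4[of "chain_sum F a (ps @ qs) - Y" "chain_sum F a ps - X"]
      by (simp add: chain_sum_append[OF ps] algebra_simps)
  qed
  then show "\<exists>\<delta>. (\<forall>t. \<delta> t > 0) \<and> (\<forall>ps. fine_chain \<delta> b c ps \<longrightarrow> norm (chain_sum F b ps - (Y - X)) \<le> \<epsilon>)"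
    using d1(1) d2(1) by (intro exI[of _ ?d]) auto
qed

section \<open>Reflection, translation and behaviour at an endpoint\<close>

lemma fine_chain_reflect:
  assumes "fine_chain \<delta> a b ps"
  shows "\<exists>qs. fine_chain (\<lambda>t. \<delta> (- t)) (- b) (- a) qs \<and>
    chain_sum F a ps = chain_sum (\<lambda>t u v. F (- t) (- v) (- u)) (- b) qs"
  using assms
proof (induction ps arbitrary: a)
  case Nil
  then show ?case by (intro exI[of _ "[]"]) auto
next
  case (Cons p ps)
  obtain t c where p: "p = (t, c)" by force
  then obtain qs where qs: "fine_chain (\<lambda>t. \<delta> (- t)) (- b) (- c) qs"
    "chain_sum F c ps = chain_sum (\<lambda>t u v. F (- t) (- v) (- u)) (- b) qs"
    using Cons by force
  have "fine_chain (\<lambda>t. \<delta> (- t)) (- c) (- a) [(- t, - a)]" using Cons.prems p by auto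
  from fine_chain_append[OF qs(1) this] show ?case
    using p by (intro exI[of _ "qs @ [(- t, - a)]"])
      (simp add: chain_sum_append[OF qs(1)] qs(2))
qed

text \<open>Reflection swaps the endpoints of each interval, hence the order \<open>- v\<close>,
  \<open>- u\<close>. Statements about left neighbourhoods are derived from those about right
  neighbourhoods through this lemma.\<close>

lemma has_kint_reflect:
  assumes "has_kint F a b X"
  shows "has_kint (\<lambda>t u v. F (- t) (- v) (- u)) (- b) (- a) X"
  unfolding has_kint_def
proof (intro allI impI)
  fix \<epsilon> :: real
  assume "\<epsilon> > 0"
  then obtain \<delta> where d: "\<And>t. \<delta> t > 0"
    "\<And>ps. fine_chain \<delta> a b ps \<Longrightarrow> norm (chain_sum F a ps - X) \<le> \<epsilon>"
    using has_kintE[OF assms] by blast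
  have "norm (chain_sum (\<lambda>t u v. F (- t) (- v) (- u)) (- b) ps - X) \<le> \<epsilon>"
    if "fine_chain (\<lambda>t. \<delta> (- t)) (- b) (- a) ps" for ps
    using fine_chain_reflect[OF that, of "\<lambda>t u v. F (- t) (- v) (- u)"] d(2) by auto
  then show "\<exists>\<delta>. (\<forall>t. \<delta> t > 0) \<and> (\<forall>ps. fine_chain \<delta> (- b) (- a) ps \<longrightarrow>
      norm (chain_sum (\<lambda>t u v. F (- t) (- v) (- u)) (- b) ps - X) \<le> \<epsilon>)"
    using d(1) by (intro exI[of _ "\<lambda>t. \<delta> (- t)"]) auto
qed

lemma has_kint_diff_left:
  assumes "has_kint F b c X" "has_kint F a c Y" "b \<le> c"
  shows "has_kint F a b (Y - X)"
  using has_kint_reflect[OF has_kint_diff_right[OF has_kint_reflect[OF assms(1)]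
        has_kint_reflect[OF assms(2)]]] assms(3) by simp

lemma fine_chain_shift:
  assumes "fine_chain \<delta> a b ps"
  shows "fine_chain (\<lambda>t. \<delta> (t - h)) (a + h) (b + h) (map (\<lambda>(t, c). (t + h, c + h)) ps) \<and>
    chain_sum F (a + h) (map (\<lambda>(t, c). (t + h, c + h)) ps) =
    chain_sum (\<lambda>t u v. F (t + h) (u + h) (v + h)) a ps"
  using assms by (induction ps arbitrary: a) auto

lemma has_kint_shift:
  assumes "has_kint F (a + h) (b + h) X"
  shows "has_kint (\<lambda>t u v. F (t + h) (u + h) (v + h)) a b X"
  unfolding has_kint_def
proof (intro allI impI)
  fix \<epsilon> :: real
  assume "\<epsilon> > 0"
  then obtain \<delta> where d: "\<And>t. \<delta> t > 0"
    "\<And>ps. fine_chain \<delta> (a + h) (b + h) ps \<Longrightarrow> norm (chain_sum F (a + h) ps - X) \<le> \<epsilon>"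
    using has_kintE[OF assms] by blast
  have "norm (chain_sum (\<lambda>t u v. F (t + h) (u + h) (v + h)) a ps - X) \<le> \<epsilon>"
    if "fine_chain (\<lambda>t. \<delta> (t + h)) a b ps" for ps
    using fine_chain_shift[OF that, of h F] d(2)[of "map (\<lambda>(t, c). (t + h, c + h)) ps"] by simp
  then show "\<exists>\<delta>. (\<forall>t. \<delta> t > 0) \<and> (\<forall>ps. fine_chain \<delta> a b ps \<longrightarrow>
      norm (chain_sum (\<lambda>t u v. F (t + h) (u + h) (v + h)) a ps - X) \<le> \<epsilon>)"
    using d(1) by (intro exI[of _ "\<lambda>t. \<delta> (t + h)"]) auto
qed

text \<open>A suitable gauge forces the first interval of every chain to carry the tag
  \<open>x\<close> and to be short. All other intervals contribute equally to both sums, so the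
  integrals differ by the limit of the difference on that first interval. This is how a jump at the
  left endpoint is accounted for.\<close>

lemma has_kint_change_left_end:
  assumes "has_kint G x b X" "x < b"
    and eq: "\<And>t u v. x < u \<Longrightarrow> u \<le> t \<Longrightarrow> t \<le> v \<Longrightarrow> v \<le> b \<Longrightarrow> F t u v = G t u v"
    and L: "((\<lambda>v. F x x v - G x x v) \<longlongrightarrow> L) (at_right x)"
  shows "has_kint F x b (X + L)"
  unfolding has_kint_def
proof (intro allI impI)
  fix \<epsilon> :: real
  assume "\<epsilon> > 0"
  then have e: "\<epsilon> / 2 > 0" by simp
  obtain d where d: "\<And>t. d t > 0"
    "\<And>ps. fine_chain d x b ps \<Longrightarrow> norm (chain_sum G x ps - X) \<le> \<epsilon> / 2"
    using has_kintE[OF assms(1) e] by blast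
  obtain c where c: "c > x" "\<And>v. x < v \<Longrightarrow> v < c \<Longrightarrow> norm (F x x v - G x x v - L) < \<epsilon> / 2"
    using tendstoD[OF L e] unfolding eventually_at_right_field dist_norm by blast
  \<comment> \<open>A tag other than \<open>x\<close> cannot reach back to \<open>x\<close>, and the
    bound \<open>c - x\<close> keeps the first interval within the range where the difference is
    close to \<open>L\<close>.\<close>
  define \<delta> where "\<delta> t = (if t = x then min (d x) (c - x) else min (d t) \<bar>t - x\<bar>)" for t
  have \<delta>: "\<delta> t > 0" "\<delta> t \<le> d t" for t using d(1)[of t] c(1) by (auto simp: \<delta>_def)
  have "norm (chain_sum F x ps - (X + L)) \<le> \<epsilon>" if ps: "fine_chain \<delta> x b ps" for ps
  proof -
    obtain t e qs where p: "ps = (t, e) # qs" using ps \<open>x < b\<close> by (cases ps) auto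
    have t: "t = x" using ps p by (auto simp: \<delta>_def split: if_splits)
    have xe: "x < e" "e < c" and q: "fine_chain \<delta> e b qs" using ps p t by (auto simp: \<delta>_def)
    have "chain_sum F e qs = chain_sum G e qs"
      by (rule chain_sum_cong[OF q]) (use eq xe in simp)
    then have "chain_sum F x ps - (X + L) =
        (chain_sum G x ps - X) + (F x x e - G x x e - L)"
      by (simp add: p t)
    also have "norm \<dots> \<le> \<epsilon> / 2 + \<epsilon> / 2"
      using d(2)[OF fine_chain_mono[OF ps \<delta>(2)]] c(2)[OF xe]
      by (intro norm_triangle_le add_mono) auto
    finally show ?thesis by simp
  qed
  then show "\<exists>\<delta>. (\<forall>t. \<delta> t > 0) \<and> (\<forall>ps. fine_chain \<delta> x b ps \<longrightarrow> norm (chain_sum F x ps - (X + L)) \<le> \<epsilon>)"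
    using \<delta>(1) by blast
qed

text \<open>For every \<open>t\<close> close to \<open>x\<close>, a fine chain of
  \<open>{x..b}\<close> may start with the interval from \<open>x\<close> to \<open>t\<close> tagged
  by \<open>x\<close>. If the rest is fine also for the integral from \<open>t\<close> to
  \<open>b\<close>, subtracting leaves only the value of \<open>F\<close> on the first interval and
  the increment of \<open>K\<close>.\<close>

lemma kprim_right_limit:
  assumes "kprim F {x..b} K" "x < b"
  shows "((\<lambda>t. K t - K x - F x x t) \<longlongrightarrow> 0) (at_right x)"
proof (rule tendstoI)
  fix \<epsilon> :: real
  assume "\<epsilon> > 0"
  then have e: "\<epsilon> / 3 > 0" by simp
  have xb: "has_kint F x b (K b - K x)" using assms unfolding kprim_def by auto
  obtain d where d: "\<And>t. d t > 0"
    "\<And>ps. fine_chain d x b ps \<Longrightarrow> norm (chain_sum F x ps - (K b - K x)) \<le> \<epsilon> / 3"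
    using has_kintE[OF xb e] by blast
  have "dist (K t - K x - F x x t) 0 < \<epsilon>" if t: "x < t" "t < min b (x + d x)" for t
  proof -
    have tb: "has_kint F t b (K b - K t)" using assms t unfolding kprim_def by auto
    obtain d' where d': "\<And>t. d' t > 0"
      "\<And>ps. fine_chain d' t b ps \<Longrightarrow> norm (chain_sum F t ps - (K b - K t)) \<le> \<epsilon> / 3"
      using has_kintE[OF tb e] by blast
    let ?d = "\<lambda>t. min (d t) (d' t)"
    obtain ps where ps: "fine_chain ?d t b ps"
      using fine_chain_exists[of t b ?d] d(1) d'(1) t by auto
    have "fine_chain d x b ((x, t) # ps)" using fine_chain_mono[OF ps, of d] t d(1) by auto
    from d(2)[OF this] have "norm (F x x t + chain_sum F t ps - (K b - K x)) \<le> \<epsilon> / 3" by simp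
    moreover have "norm (chain_sum F t ps - (K b - K t)) \<le> \<epsilon> / 3"
      using d'(2) fine_chain_mono[OF ps, of d'] by auto
    ultimately have "norm (K t - K x - F x x t) \<le> 2 * \<epsilon> / 3"
      using norm_triangle_ineq4[of "chain_sum F t ps - (K b - K t)"
          "F x x t + chain_sum F t ps - (K b - K x)"] by (simp add: algebra_simps)
    then show ?thesis using \<open>\<epsilon> > 0\<close> by (simp add: dist_norm)
  qed
  moreover have "x < min b (x + d x)" using assms d(1) by auto
  ultimately show "\<forall>\<^sub>F t in at_right x. dist (K t - K x - F x x t) 0 < \<epsilon>"
    unfolding eventually_at_right_field by blast
qed

section \<open>Primitives on adjacent intervals\<close>

lemma kprim_shift_value: "kprim F S (\<lambda>t. K t + c) \<longleftrightarrow> kprim F S K"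
  by (simp add: kprim_def)

lemma kprim_subset: "kprim F S K \<Longrightarrow> T \<subseteq> S \<Longrightarrow> kprim F T K"
  unfolding kprim_def by blast

lemma kprim_combine:
  assumes "kprim F {a..b} K" "kprim F {b..c} K"
    and F: "\<And>u v. u \<le> b \<Longrightarrow> b \<le> v \<Longrightarrow> F b u v = F b u b + F b b v" "F b b b = 0"
  shows "kprim F {a..c} K"
  unfolding kprim_def
proof (intro ballI impI)
  fix s t
  assume st: "s \<in> {a..c}" "t \<in> {a..c}" "s \<le> t"
  consider "t \<le> b" | "s \<ge> b" | "s \<le> b" "b \<le> t" by linarith
  then show "has_kint F s t (K t - K s)"
  proof cases
    case 3
    then have "has_kint F s b (K b - K s)" "has_kint F b t (K t - K b)"
      using assms(1,2) st unfolding kprim_def by auto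
    from has_kint_combine[OF this 3 F] show ?thesis by (simp add: algebra_simps)
  qed (use assms(1,2) st in \<open>auto simp: kprim_def\<close>)
qed

section \<open>Stieltjes integrals with respect to functions of bounded variation\<close>

lemma fine_chain_refl [simp]: "fine_chain \<delta> a a ps \<longleftrightarrow> ps = []"
  using fine_chain_le by (cases ps) fastforce+

lemma chain_sum_diff:
  "chain_sum (\<lambda>t u v. F t u v - G t u v) a ps = chain_sum F a ps - chain_sum G a ps"
  by (induction ps arbitrary: a) (auto simp: algebra_simps)

lemma chain_sum_telescope:
  "fine_chain \<delta> a b ps \<Longrightarrow> chain_sum (\<lambda>t u v. K v - K u) a ps = K b - K a"
  by (induction ps arbitrary: a) auto

lemma norm_chain_sum_le:
  assumes "fine_chain \<delta> a b ps"
    and "\<And>t u v. a \<le> u \<Longrightarrow> u \<le> t \<Longrightarrow> t \<le> v \<Longrightarrow> v \<le> b \<Longrightarrow> u < v \<Longrightarrow> norm (F t u v) \<le> W v - W u"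
  shows "norm (chain_sum F a ps) \<le> W b - W a"
  using assms
proof (induction ps arbitrary: a)
  case (Cons p ps)
  obtain t c where p: "p = (t, c)" by force
  then have c: "fine_chain \<delta> c b ps" and ac: "a < c" "a \<le> t" "t \<le> c" using Cons.prems by auto
  then have "c \<le> b" using fine_chain_le by blast
  then have "norm (F t a c) \<le> W c - W a" using Cons.prems(2) ac by blast
  moreover have "norm (chain_sum F c ps) \<le> W b - W c"
    by (rule Cons.IH[OF c]) (rule Cons.prems(2), use ac in simp_all)
  ultimately show ?case using p norm_triangle_ineq[of "F t a c" "chain_sum F c ps"] by simp
qed simp

text \<open>A Cauchy condition at a fixed error: the sums over all sufficiently fine chains lie in
  one ball of radius \<open>e\<close>. Unlike the existence of an integral, it can be established
  locally with small errors and then added up over adjacent intervals.\<close>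

definition kint_approx :: "(real \<Rightarrow> real \<Rightarrow> real \<Rightarrow> 'a::real_normed_vector) \<Rightarrow> real \<Rightarrow> real \<Rightarrow> real \<Rightarrow> bool" where
  "kint_approx F a b e \<longleftrightarrow> (\<exists>X \<delta>. (\<forall>t. \<delta> t > 0) \<and>
     (\<forall>ps. fine_chain \<delta> a b ps \<longrightarrow> norm (chain_sum F a ps - X) \<le> e))"

lemma kint_approx_mono: "kint_approx F a b e \<Longrightarrow> e \<le> e' \<Longrightarrow> kint_approx F a b e'"
  unfolding kint_approx_def by (meson order_trans)

lemma kint_approx_combine:
  assumes "kint_approx F a b e1" "kint_approx F b c e2" "a \<le> b" "b \<le> c"
    and F: "\<And>u v. u \<le> b \<Longrightarrow> b \<le> v \<Longrightarrow> F b u v = F b u b + F b b v" "F b b b = 0"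
  shows "kint_approx F a c (e1 + e2)"
proof -
  obtain X d1 where 1: "\<And>t. d1 t > 0"
    "\<And>ps. fine_chain d1 a b ps \<Longrightarrow> norm (chain_sum F a ps - X) \<le> e1"
    using assms(1) unfolding kint_approx_def by blast
  obtain Y d2 where 2: "\<And>t. d2 t > 0"
    "\<And>ps. fine_chain d2 b c ps \<Longrightarrow> norm (chain_sum F b ps - Y) \<le> e2"
    using assms(2) unfolding kint_approx_def by blast
  from has_kint_approx_combine[of d1 a b F X e1 d2 c Y e2, OF 1 2 F assms(3,4)] show ?thesis
    unfolding kint_approx_def by blast
qed

text \<open>The minus sign is there because reversing time negates the increments of the integrator:
  for a Stieltjes function \<open>F\<close> the reflected function with this sign is again of
  Stieltjes type.\<close>

lemma kint_approx_reflect: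
  assumes "kint_approx (\<lambda>t u v. - F (- t) (- v) (- u)) (- b) (- a) e"
  shows "kint_approx F a b e"
proof -
  obtain X \<delta> where d: "\<And>t. \<delta> t > 0"
    "\<And>ps. fine_chain \<delta> (- b) (- a) ps \<Longrightarrow>
      norm (chain_sum (\<lambda>t u v. - F (- t) (- v) (- u)) (- b) ps - X) \<le> e"
    using assms unfolding kint_approx_def by blast
  have "norm (chain_sum F a ps - (- X)) \<le> e" if ps: "fine_chain (\<lambda>t. \<delta> (- t)) a b ps" for ps
  proof -
    obtain qs where q: "fine_chain \<delta> (- b) (- a) qs"
      "chain_sum F a ps = chain_sum (\<lambda>t u v. F (- t) (- v) (- u)) (- b) qs"
      using fine_chain_reflect[OF ps, of F] by auto
    have "chain_sum (\<lambda>t u v. - F (- t) (- v) (- u)) (- b) qs = - chain_sum F a ps"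
      unfolding q(2) by (rule chain_sum_linear) (simp add: linear_uminus)
    then show ?thesis using d(2)[OF q(1)] norm_minus_commute[of "- chain_sum F a ps" X]
      by (simp add: add.commute)
  qed
  then show ?thesis
    unfolding kint_approx_def using d(1) by (intro exI[of _ "- X"] exI[of _ "\<lambda>t. \<delta> (- t)"]) auto
qed

text \<open>Centres belonging to the errors \<open>1 / (n + 1)\<close> form a Cauchy sequence, since
  a chain fine for two gauges has its sum in both balls. Completeness supplies the integral.\<close>

lemma has_kint_if_kint_approx:
  fixes F :: "real \<Rightarrow> real \<Rightarrow> real \<Rightarrow> 'a::banach"
  assumes ap: "\<And>e. e > 0 \<Longrightarrow> kint_approx F a b e" and "a \<le> b"
  shows "\<exists>X. has_kint F a b X"
proof -
  have "\<exists>X \<delta>. (\<forall>t. \<delta> t > 0) \<and>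
     (\<forall>ps. fine_chain \<delta> a b ps \<longrightarrow> norm (chain_sum F a ps - X) \<le> inverse (Suc n))" for n
    using ap[of "inverse (Suc n)"] unfolding kint_approx_def by simp
  then obtain X D where D: "\<And>n t. D n t > 0"
     "\<And>n ps. fine_chain (D n) a b ps \<Longrightarrow> norm (chain_sum F a ps - X n) \<le> inverse (Suc n)"
    by metis
  have X: "norm (X m - X n) \<le> inverse (Suc m) + inverse (Suc n)" for m n
  proof -
    let ?d = "\<lambda>t. min (D m t) (D n t)"
    obtain ps where ps: "fine_chain ?d a b ps"
      using fine_chain_exists[OF assms(2), of ?d] D(1) by auto
    have "norm (chain_sum F a ps - X m) \<le> inverse (Suc m)"
      "norm (chain_sum F a ps - X n) \<le> inverse (Suc n)"
      using fine_chain_mono[OF ps, of "D m"] fine_chain_mono[OF ps, of "D n"] D(2) by auto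
    then show ?thesis
      using norm_triangle_ineq4[of "chain_sum F a ps - X n" "chain_sum F a ps - X m"] by simp
  qed
  have "Cauchy X"
  proof (rule CauchyI)
    fix e :: real
    assume "e > 0"
    then obtain N where N: "inverse (real (Suc N)) < e / 2"
      using reals_Archimedean[of "e / 2"] by auto
    have "norm (X m - X n) < e" if "m \<ge> N" "n \<ge> N" for m n
    proof -
      have "inverse (real (Suc m)) \<le> inverse (real (Suc N))"
        "inverse (real (Suc n)) \<le> inverse (real (Suc N))"
        using that by (auto simp: field_simps)
      then show ?thesis using X[of m n] N by linarith
    qed
    then show "\<exists>M. \<forall>m\<ge>M. \<forall>n\<ge>M. norm (X m - X n) < e" by blast
  qed
  then obtain Y where Y: "X \<longlonglongrightarrow> Y" using Cauchy_convergent convergent_def by blast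
  have "has_kint F a b Y"
    unfolding has_kint_def
  proof (intro allI impI)
    fix \<epsilon> :: real
    assume "\<epsilon> > 0"
    then have e: "\<epsilon> / 2 > 0" by simp
    have "\<forall>\<^sub>F n in sequentially. inverse (real (Suc n)) < \<epsilon> / 2 \<and> dist (X n) Y < \<epsilon> / 2"
      using order_tendstoD(2)[OF LIMSEQ_inverse_real_of_nat e] tendstoD[OF Y e]
      by (rule eventually_conj)
    then obtain n where n: "inverse (real (Suc n)) < \<epsilon> / 2" "dist (X n) Y < \<epsilon> / 2"
      by (auto simp: eventually_sequentially)
    have "norm (chain_sum F a ps - Y) \<le> \<epsilon>" if "fine_chain (D n) a b ps" for ps
      using D(2)[OF that] n norm_triangle_ineq[of "chain_sum F a ps - X n" "X n - Y"]
      by (simp add: dist_norm)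
    then show "\<exists>\<delta>. (\<forall>t. \<delta> t > 0) \<and> (\<forall>ps. fine_chain \<delta> a b ps \<longrightarrow> norm (chain_sum F a ps - Y) \<le> \<epsilon>)"
      using D(1) by blast
  qed
  then show ?thesis by blast
qed

text \<open>The equation of the transition matrix provides integrals only from the base time.
  Increments between two arbitrary times follow by subtraction on one side of \<open>p\<close> and
  by addition across \<open>p\<close>.\<close>

lemma kprim_from_base:
  assumes "\<And>t. p \<le> t \<Longrightarrow> t \<in> S \<Longrightarrow> has_kint F p t (K t - K p)"
    and "\<And>t. t \<le> p \<Longrightarrow> t \<in> S \<Longrightarrow> has_kint F t p (K p - K t)"
    and F: "\<And>u v. u \<le> p \<Longrightarrow> p \<le> v \<Longrightarrow> F p u v = F p u p + F p p v" "F p p p = 0"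
  shows "kprim F S K"
  unfolding kprim_def
proof (intro ballI impI)
  fix s t
  assume st: "s \<in> S" "t \<in> S" "s \<le> t"
  consider "p \<le> s" | "t \<le> p" | "s \<le> p" "p \<le> t" by linarith
  then show "has_kint F s t (K t - K s)"
  proof cases
    case 1
    then show ?thesis using has_kint_diff_right[OF assms(1)[of s] assms(1)[of t]] st by simp
  next
    case 2
    then show ?thesis using has_kint_diff_left[OF assms(2)[of t] assms(2)[of s]] st by simp
  next
    case 3
    then show ?thesis
      using has_kint_combine[OF assms(2)[of s] assms(1)[of t] 3 F] st by (simp add: algebra_simps)
  qed
qed

definition stieltjes ::
  "(real \<Rightarrow> real^'n^'n) \<Rightarrow> (real \<Rightarrow> real^'n) \<Rightarrow> real \<Rightarrow> real \<Rightarrow> real \<Rightarrow> real^'n" where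
  "stieltjes A g t u v = (A v - A u) *v g t"

section \<open>Algebra of Stieltjes primitives\<close>

lemma stieltjes_split: "stieltjes A g t u v = stieltjes A g t u w + stieltjes A g t w v"
  by (simp add: stieltjes_def flip: matrix_vector_mult_add_rdistrib)

lemma stieltjes_null [simp]: "stieltjes A g t u u = 0"
  by (simp add: stieltjes_def)

lemma stieltjes_add: "stieltjes A (\<lambda>r. g r + h r) t u v = stieltjes A g t u v + stieltjes A h t u v"
  by (simp add: stieltjes_def matrix_vector_right_distrib)

lemma stieltjes_diff: "stieltjes A (\<lambda>r. g r - h r) t u v = stieltjes A g t u v - stieltjes A h t u v"
  by (simp add: stieltjes_def matrix_vector_mult_diff_distrib)

lemma stieltjes_scaleR: "stieltjes A (\<lambda>r. c *\<^sub>R g r) t u v = c *\<^sub>R stieltjes A g t u v"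
  by (simp add: stieltjes_def matrix_vector_mult_scaleR)

lemma kprim_stieltjes_combine:
  "kprim (stieltjes A g) {a..b} K \<Longrightarrow> kprim (stieltjes A g) {b..c} K \<Longrightarrow> kprim (stieltjes A g) {a..c} K"
  by (rule kprim_combine) (auto intro: stieltjes_split)

lemma kprim_cong:
  assumes "kprim F S K"
    and "\<And>s t. s \<in> S \<Longrightarrow> t \<in> S \<Longrightarrow> s \<le> t \<Longrightarrow> K' t - K' s = K t - K s"
    and "\<And>s s' t u v. s \<in> S \<Longrightarrow> s' \<in> S \<Longrightarrow> s \<le> u \<Longrightarrow> u \<le> t \<Longrightarrow> t \<le> v \<Longrightarrow> v \<le> s' \<Longrightarrow> F' t u v = F t u v"
  shows "kprim F' S K'"
  unfolding kprim_def
proof (intro ballI impI)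
  fix s t
  assume st: "s \<in> S" "t \<in> S" "s \<le> t"
  have "has_kint F s t (K t - K s)" using assms(1) st unfolding kprim_def by blast
  then have "has_kint F' s t (K t - K s)"
    by (rule has_kint_cong) (use assms(3) st in metis)
  then show "has_kint F' s t (K' t - K' s)" using assms(2) st by simp
qed

lemma kprim_add:
  assumes "kprim F S K" "kprim G S L"
  shows "kprim (\<lambda>t u v. F t u v + G t u v) S (\<lambda>t. K t + L t)"
  unfolding kprim_def
proof (intro ballI impI)
  fix s t
  assume st: "s \<in> S" "t \<in> S" "s \<le> t"
  then have "has_kint (\<lambda>t u v. F t u v + G t u v) s t ((K t - K s) + (L t - L s))"
    using assms unfolding kprim_def by (intro has_kint_add) auto
  then show "has_kint (\<lambda>t u v. F t u v + G t u v) s t (K t + L t - (K s + L s))"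
    by (simp add: algebra_simps)
qed

lemma kprim_linear:
  assumes "bounded_linear h" "kprim F S K"
  shows "kprim (\<lambda>t u v. h (F t u v)) S (\<lambda>t. h (K t))"
  using assms(2) has_kint_linear[OF assms(1)]
  unfolding kprim_def linear_diff[OF bounded_linear.linear[OF assms(1)], symmetric] by blast

lemma kprim_stieltjes_add:
  assumes "kprim (stieltjes A g) S K" "kprim (stieltjes A h) S L"
  shows "kprim (stieltjes A (\<lambda>r. g r + h r)) S (\<lambda>t. K t + L t)"
  using kprim_add[OF assms] by (simp add: stieltjes_add[abs_def])

lemma kprim_stieltjes_scaleR:
  assumes "kprim (stieltjes A g) S K"
  shows "kprim (stieltjes A (\<lambda>r. c *\<^sub>R g r)) S (\<lambda>t. c *\<^sub>R K t)"
  using kprim_linear[OF bounded_linear_scaleR_right assms, of c]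
  by (simp add: stieltjes_scaleR[abs_def])

lemma kprim_stieltjes_diff:
  assumes "kprim (stieltjes A g) S K" "kprim (stieltjes A h) S L"
  shows "kprim (stieltjes A (\<lambda>r. g r - h r)) S (\<lambda>t. K t - L t)"
  using kprim_stieltjes_add[OF assms(1) kprim_stieltjes_scaleR[OF assms(2), of "-1"]] by simp

lemma kprim_stieltjes_sum:
  assumes "\<And>i. i \<in> I \<Longrightarrow> kprim (stieltjes A (g i)) S (K i)"
  shows "kprim (stieltjes A (\<lambda>r. \<Sum>i\<in>I. g i r)) S (\<lambda>t. \<Sum>i\<in>I. K i t)"
proof -
  \<comment> \<open>The zero primitive serves the empty sum, and also infinite \<open>I\<close>,
    where sums are 0 by convention.\<close>
  have z: "kprim (stieltjes A (\<lambda>r. 0)) S (\<lambda>t. 0)"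
    unfolding kprim_def has_kint_def
  proof (intro ballI impI allI)
    fix s t e :: real
    assume "e > 0"
    moreover have "chain_sum (stieltjes A (\<lambda>r. 0)) s ps = 0" for ps
      by (induction ps arbitrary: s) (auto simp: stieltjes_def)
    ultimately show "\<exists>\<delta>. (\<forall>t. 0 < \<delta> t) \<and> (\<forall>ps. fine_chain \<delta> s t ps \<longrightarrow>
        norm (chain_sum (stieltjes A (\<lambda>r. 0)) s ps - (0 - 0)) \<le> e)"
      by (intro exI[of _ "\<lambda>_. 1"]) auto
  qed
  show ?thesis
  proof (cases "finite I")
    case True
    from this assms show ?thesis
    proof (induction I)
      case (insert i I)
      then have "kprim (stieltjes A (\<lambda>r. g i r + (\<Sum>i\<in>I. g i r))) S (\<lambda>t. K i t + (\<Sum>i\<in>I. K i t))"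
        by (intro kprim_stieltjes_add) auto
      then show ?case using insert by simp
    qed (simp add: z)
  qed (simp add: z)
qed

text \<open>Reversal negates the increments of the integrator and those of the primitive; the two
  signs cancel.\<close>

lemma kprim_stieltjes_reflect:
  assumes "kprim (stieltjes A g) S K"
  shows "kprim (stieltjes (\<lambda>t. A (- t)) (\<lambda>t. g (- t))) (uminus ` S) (\<lambda>t. K (- t))"
  unfolding kprim_def
proof (intro ballI impI)
  fix s t
  assume st: "s \<in> uminus ` S" "t \<in> uminus ` S" "s \<le> t"
  then have "- t \<in> S" "- s \<in> S" "- t \<le> - s" by auto
  then have "has_kint (stieltjes A g) (- t) (- s) (K (- s) - K (- t))"
    using assms unfolding kprim_def by blast
  from has_kint_linear[OF bounded_linear_minus[OF bounded_linear_ident] has_kint_reflect[OF this]]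
  have "has_kint (\<lambda>t u v. - stieltjes A g (- t) (- v) (- u)) s t (K (- t) - K (- s))" by simp
  then show "has_kint (stieltjes (\<lambda>t. A (- t)) (\<lambda>t. g (- t))) s t (K (- t) - K (- s))"
    by (rule has_kint_cong) (simp add: stieltjes_def algebra_simps)
qed

section \<open>Integrators with dominated increments, estimates and one-sided limits\<close>

lemma tendsto_matrix_vector_mult_left:
  fixes L :: "real^'n^'m"
  assumes "(f \<longlongrightarrow> L) F"
  shows "((\<lambda>t. f t *v x) \<longlongrightarrow> L *v x) F"
  unfolding matrix_vector_mult_def
  by (intro tendsto_vec_lambda tendsto_sum tendsto_mult tendsto_const tendsto_vec_nth assms)

text \<open>The working form of locally bounded variation. Tested on vectors, it estimates Stieltjes
  sums directly, and it survives reflection and the replacement of a value by a right limit, with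
  \<open>V\<close> changed accordingly.\<close>

definition bv_by :: "(real \<Rightarrow> real^'n^'n) \<Rightarrow> (real \<Rightarrow> real) \<Rightarrow> bool" where
  "bv_by A V \<longleftrightarrow> (\<forall>s t x. s \<le> t \<longrightarrow> norm ((A t - A s) *v x) \<le> (V t - V s) * norm x)"

lemma bv_byD: "bv_by A V \<Longrightarrow> s \<le> t \<Longrightarrow> norm ((A t - A s) *v x) \<le> (V t - V s) * norm x"
  unfolding bv_by_def by blast

lemma bv_by_mono:
  fixes A :: "real \<Rightarrow> real^'n^'n"
  assumes "bv_by A V"
  shows "mono V"
proof (rule monoI)
  fix s t :: real
  assume "s \<le> t"
  \<comment> \<open>Any unit vector gives monotonicity; \<open>undefined\<close> is just some
    index.\<close>
  then have "norm ((A t - A s) *v axis undefined 1) \<le> (V t - V s) * norm (axis undefined 1 :: real^'n)"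
    using assms bv_byD by blast
  then have "0 \<le> (V t - V s) * norm (axis undefined 1 :: real^'n)" using norm_ge_zero order_trans by blast
  then show "V s \<le> V t" by (simp add: norm_axis_1)
qed

lemma bv_by_reflect:
  fixes A :: "real \<Rightarrow> real^'n^'n"
  assumes "bv_by A V"
  shows "bv_by (\<lambda>t. A (- t)) (\<lambda>t. - V (- t))"
  unfolding bv_by_def
proof (intro allI impI)
  fix s t :: real and x :: "real^'n"
  assume "s \<le> t"
  then have "norm ((A (- s) - A (- t)) *v x) \<le> (V (- s) - V (- t)) * norm x"
    using bv_byD[OF assms, of "- t" "- s"] by simp
  moreover have "(A (- t) - A (- s)) *v x = - ((A (- s) - A (- t)) *v x)"
    by (simp add: algebra_simps)
  ultimately show "norm ((A (- t) - A (- s)) *v x) \<le> (- V (- t) - - V (- s)) * norm x" by simp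
qed

lemma norm_stieltjes_le:
  assumes "bv_by A V" "u \<le> v" "norm (g t) \<le> M"
  shows "norm (stieltjes A g t u v) \<le> M * V v - M * V u"
proof -
  have "norm (stieltjes A g t u v) \<le> (V v - V u) * norm (g t)"
    unfolding stieltjes_def by (rule bv_byD[OF assms(1,2)])
  also have "\<dots> \<le> (V v - V u) * M"
    using monoD[OF bv_by_mono[OF assms(1)] assms(2)] assms(3) by (intro mult_left_mono) auto
  finally show ?thesis by (simp add: algebra_simps)
qed

lemma norm_chain_sum_stieltjes_le:
  assumes "bv_by A V" "fine_chain \<delta> a b ps" "\<And>t. t \<in> {a..b} \<Longrightarrow> norm (g t) \<le> M"
  shows "norm (chain_sum (stieltjes A g) a ps) \<le> M * (V b - V a)"
  using norm_chain_sum_le[OF assms(2), of "stieltjes A g" "\<lambda>t. M * V t"]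
    norm_stieltjes_le[OF assms(1)] assms(3) by (simp add: algebra_simps)

lemma norm_has_kint_le:
  assumes "bv_by A V" "has_kint (stieltjes A g) a b X" "a \<le> b" "\<And>t. t \<in> {a..b} \<Longrightarrow> norm (g t) \<le> M"
  shows "norm X \<le> M * (V b - V a)"
proof (rule field_le_epsilon)
  fix e :: real
  assume "e > 0"
  then obtain \<delta> where d: "\<And>t. \<delta> t > 0"
    "\<And>ps. fine_chain \<delta> a b ps \<Longrightarrow> norm (chain_sum (stieltjes A g) a ps - X) \<le> e"
    using has_kintE[OF assms(2)] by blast
  obtain ps where ps: "fine_chain \<delta> a b ps" using fine_chain_exists[OF assms(3), of \<delta>] d(1) by blast
  have "norm (chain_sum (stieltjes A g) a ps) \<le> M * (V b - V a)"
    by (rule norm_chain_sum_stieltjes_le[OF assms(1) ps assms(4)])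
  then show "norm X \<le> M * (V b - V a) + e"
    using d(2)[OF ps] norm_triangle_ineq4[of "chain_sum (stieltjes A g) a ps"
        "chain_sum (stieltjes A g) a ps - X"] by simp
qed

lemma kprim_lipschitz:
  assumes "bv_by A V" "kprim (stieltjes A g) {a..b} K" "\<And>t. t \<in> {a..b} \<Longrightarrow> norm (g t) \<le> M"
    and "a \<le> s" "s \<le> t" "t \<le> b"
  shows "norm (K t - K s) \<le> M * (V t - V s)"
proof (rule norm_has_kint_le[OF assms(1)])
  show "has_kint (stieltjes A g) s t (K t - K s)" using assms unfolding kprim_def by auto
qed (use assms in auto)

lemma mono_right_limit:
  fixes V :: "real \<Rightarrow> real"
  assumes "mono V"
  shows "\<exists>L. (V \<longlongrightarrow> L) (at_right x) \<and> (\<forall>t>x. L \<le> V t) \<and> (\<forall>s\<le>x. V s \<le> L)"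
proof -
  have bd: "bdd_below (V ` {x<..})" using monoD[OF assms] by (intro bdd_belowI2[of _ "V x"]) auto
  have "(V \<longlongrightarrow> Inf (V ` ({x<..} \<inter> UNIV))) (at x within ({x<..} \<inter> UNIV))"
    by (rule Lim_right_bound[where K="V x"]) (use monoD[OF assms] in auto)
  moreover have "Inf (V ` {x<..}) \<le> V t" if "t > x" for t
    using bd that by (intro cInf_lower) auto
  moreover have "V s \<le> Inf (V ` {x<..})" if "s \<le> x" for s
    by (rule cInf_greatest) (use monoD[OF assms] that in auto)
  ultimately show ?thesis by auto
qed

text \<open>Convergence of \<open>V\<close> from the right makes \<open>h\<close> Cauchy along
  \<open>x + 1 / (n + 1)\<close>. Letting the second argument run along this sequence bounds the
  distance of \<open>h t\<close> from the limit by \<open>\<bar>M * V t - M * Lv\<bar>\<close>,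
  which covers all approaches to \<open>x\<close>.\<close>

lemma right_limit_if_dominated:
  fixes h :: "real \<Rightarrow> 'a::banach"
  assumes "mono V" and h: "\<And>s t. s \<le> t \<Longrightarrow> norm (h t - h s) \<le> M * (V t - V s)"
  shows "\<exists>L. (h \<longlongrightarrow> L) (at_right x)"
proof -
  obtain Lv where Lv: "(V \<longlongrightarrow> Lv) (at_right x)" using mono_right_limit[OF assms(1)] by blast
  define s where "s n = x + inverse (real (Suc n))" for n
  have sx: "s n > x" for n by (simp add: s_def)
  have "s \<longlonglongrightarrow> x + 0" unfolding s_def by (intro tendsto_intros LIMSEQ_inverse_real_of_nat)
  then have s: "filterlim s (at_right x) sequentially"
    using sx by (simp add: filterlim_at order.strict_implies_not_eq[symmetric])
  have Vs: "(\<lambda>n. V (s n)) \<longlonglongrightarrow> Lv" using filterlim_compose[OF Lv s] .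
  have "Cauchy (\<lambda>n. M * V (s n))"
    by (intro convergent_Cauchy convergentI[of _ "M * Lv"] tendsto_intros Vs)
  have hab: "norm (h u - h v) \<le> \<bar>M * V u - M * V v\<bar>" for u v
    using h[of u v] h[of v u] norm_minus_commute[of "h u" "h v"]
    by (cases "u \<le> v") (auto simp: algebra_simps)
  have "Cauchy (\<lambda>n. h (s n))"
  proof (rule CauchyI)
    fix e :: real
    assume "e > 0"
    then obtain N where "\<forall>m\<ge>N. \<forall>n\<ge>N. norm (M * V (s m) - M * V (s n)) < e"
      using CauchyD[OF \<open>Cauchy (\<lambda>n. M * V (s n))\<close>] by blast
    then show "\<exists>N. \<forall>m\<ge>N. \<forall>n\<ge>N. norm (h (s m) - h (s n)) < e"
      using hab le_less_trans unfolding real_norm_def by blast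
  qed
  then obtain L where L: "(\<lambda>n. h (s n)) \<longlonglongrightarrow> L" using Cauchy_convergent convergent_def by blast
  have le: "norm (h t - L) \<le> \<bar>M * V t - M * Lv\<bar>" for t
  proof (rule LIMSEQ_le)
    show "(\<lambda>n. norm (h t - h (s n))) \<longlonglongrightarrow> norm (h t - L)" by (intro tendsto_intros L)
    show "(\<lambda>n. \<bar>M * V t - M * V (s n)\<bar>) \<longlonglongrightarrow> \<bar>M * V t - M * Lv\<bar>" by (intro tendsto_intros Vs)
  qed (use hab in auto)
  have "((\<lambda>t. \<bar>M * V t - M * Lv\<bar>) \<longlongrightarrow> \<bar>M * Lv - M * Lv\<bar>) (at_right x)"
    by (rule tendsto_rabs[OF tendsto_diff[OF tendsto_mult_left[OF Lv] tendsto_const]])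
  then have "((\<lambda>t. \<bar>M * V t - M * Lv\<bar>) \<longlongrightarrow> 0) (at_right x)"
    unfolding diff_self abs_zero .
  then have "((\<lambda>t. h t - L) \<longlongrightarrow> 0) (at_right x)"
    by (rule Lim_null_comparison[OF always_eventually[OF allI[OF le]]])
  then have "(h \<longlongrightarrow> L) (at_right x)" by (rule LIM_zero_cancel)
  then show ?thesis ..
qed

lemma left_limit_if_dominated:
  fixes h :: "real \<Rightarrow> 'a::banach"
  assumes "mono V" and h: "\<And>s t. s \<le> t \<Longrightarrow> norm (h t - h s) \<le> M * (V t - V s)"
  shows "\<exists>L. (h \<longlongrightarrow> L) (at_left x)"
proof -
  have "norm (h (- t) - h (- s)) \<le> M * (- V (- t) - - V (- s))" if "s \<le> t" for s t
    using h[of "- t" "- s"] that by (simp add: norm_minus_commute)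
  moreover have "mono (\<lambda>t. - V (- t))"
    by (rule monoI) (simp add: monoD[OF assms(1)])
  ultimately have "\<exists>L. ((\<lambda>t. h (- t)) \<longlongrightarrow> L) (at_right (- x))"
    using right_limit_if_dominated[of "\<lambda>t. - V (- t)" "\<lambda>t. h (- t)" M] by blast
  then show ?thesis by (simp add: filterlim_at_left_to_right)
qed

lemma regulated_on_if_dominated:
  fixes h :: "real \<Rightarrow> 'a::banach"
  assumes "mono V" and h: "\<And>s t. a \<le> s \<Longrightarrow> s \<le> t \<Longrightarrow> t \<le> b \<Longrightarrow> norm (h t - h s) \<le> M * (V t - V s)"
  shows "regulated_on a b h"
proof (cases "a \<le> b")
  case True
  \<comment> \<open>Clamping to the interval extends the domination to the whole line and leaves
    \<open>h\<close> unchanged on the one-sided neighbourhoods that matter.\<close>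
  define c where "c t = max a (min b t)" for t
  have c: "c s \<le> c t" if "s \<le> t" for s t using that by (auto simp: c_def)
  have m: "mono (\<lambda>t. V (c t))" using assms(1) c by (auto simp: mono_def)
  have d: "norm (h (c t) - h (c s)) \<le> M * (V (c t) - V (c s))" if "s \<le> t" for s t
    using h[of "c s" "c t"] c[OF that] True by (auto simp: c_def)
  have "\<exists>l. (h \<longlongrightarrow> l) (at_right t)" if "a \<le> t" "t < b" for t
  proof -
    have "\<forall>\<^sub>F s in at_right t. h (c s) = h s"
      unfolding eventually_at_right_field using that by (intro exI[of _ b]) (auto simp: c_def)
    then show ?thesis
      using right_limit_if_dominated[OF m d, of t] by (simp add: filterlim_cong)
  qed
  moreover have "\<exists>l. (h \<longlongrightarrow> l) (at_left t)" if "a < t" "t \<le> b" for t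
  proof -
    have "\<forall>\<^sub>F s in at_left t. h (c s) = h s"
      unfolding eventually_at_left_field using that by (intro exI[of _ a]) (auto simp: c_def)
    then show ?thesis
      using left_limit_if_dominated[OF m d, of t] by (simp add: filterlim_cong)
  qed
  ultimately show ?thesis unfolding regulated_on_def by auto
qed (auto simp: regulated_on_def)

text \<open>Applied to the standard basis vectors, the domination makes every column
  converge.\<close>

lemma bv_by_right_limit:
  fixes A :: "real \<Rightarrow> real^'n^'n"
  assumes "bv_by A V"
  shows "\<exists>L. (A \<longlongrightarrow> L) (at_right x)"
proof -
  have "\<exists>l. ((\<lambda>t. A t *v axis j 1) \<longlongrightarrow> l) (at_right x)" for j
  proof (rule right_limit_if_dominated[OF bv_by_mono[OF assms]])
    show "norm (A t *v axis j 1 - A s *v axis j 1) \<le> 1 * (V t - V s)" if "s \<le> t" for s t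
      using bv_byD[OF assms that, of "axis j 1"]
      by (simp add: norm_axis_1 matrix_vector_mult_diff_rdistrib)
  qed
  then obtain l where l: "\<And>j. ((\<lambda>t. A t *v axis j 1) \<longlongrightarrow> l j) (at_right x)" by metis
  have "(A \<longlongrightarrow> (\<chi> i j. l j $ i)) (at_right x)"
  proof (intro vec_tendstoI)
    fix i j
    show "((\<lambda>t. A t $ i $ j) \<longlongrightarrow> (\<chi> i j. l j $ i) $ i $ j) (at_right x)"
      using tendsto_vec_nth[OF l[of j], of i]
      by (simp add: matrix_vector_mult_basis column_def)
  qed
  then show ?thesis by blast
qed

section \<open>Partitions, variation and regulated functions\<close>

lemma atLeastAtMost_subset_greaterThanLessThan_iff:
  "u \<le> v \<Longrightarrow> {u..v} \<subseteq> {p<..<q} \<longleftrightarrow> p < u \<and> v < q" for u v p q :: real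
  by auto

lemma partition_of_fine_chain:
  assumes "fine_chain \<delta> a b ps"
  shows "\<exists>m \<alpha> \<tau>. is_partition a b m \<alpha> \<and>
    (\<forall>j<m. \<tau> j \<in> {\<alpha> j..\<alpha> (Suc j)} \<and>
       {\<alpha> j..\<alpha> (Suc j)} \<subseteq> {\<tau> j - \<delta> (\<tau> j)<..<\<tau> j + \<delta> (\<tau> j)}) \<and>
    (\<Sum>j<m. F (\<tau> j) (\<alpha> j) (\<alpha> (Suc j))) = chain_sum F a ps"
  using assms
proof (induction ps arbitrary: a)
  case Nil
  then show ?case by (intro exI[of _ 0] exI[of _ "\<lambda>_. a"]) (auto simp: is_partition_def)
next
  case (Cons p ps)
  obtain t c where p: "p = (t, c)" by force
  have c: "fine_chain \<delta> c b ps" using Cons.prems p by simp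
  obtain m \<alpha> \<tau> where m: "is_partition c b m \<alpha>"
    "\<forall>j<m. \<tau> j \<in> {\<alpha> j..\<alpha> (Suc j)} \<and>
       {\<alpha> j..\<alpha> (Suc j)} \<subseteq> {\<tau> j - \<delta> (\<tau> j)<..<\<tau> j + \<delta> (\<tau> j)}"
    "(\<Sum>j<m. F (\<tau> j) (\<alpha> j) (\<alpha> (Suc j))) = chain_sum F c ps"
    using Cons.IH[OF c] by blast
  let ?\<alpha> = "case_nat a \<alpha>" and ?\<tau> = "case_nat t \<tau>"
  have 0: "\<alpha> 0 = c" using m(1) by (simp add: is_partition_def)
  have "is_partition a b (Suc m) ?\<alpha>"
    using m(1) Cons.prems p by (auto simp: is_partition_def split: nat.split)
  moreover have "\<forall>j<Suc m. ?\<tau> j \<in> {?\<alpha> j..?\<alpha> (Suc j)} \<and>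
       {?\<alpha> j..?\<alpha> (Suc j)} \<subseteq> {?\<tau> j - \<delta> (?\<tau> j)<..<?\<tau> j + \<delta> (?\<tau> j)}"
    using m(2) Cons.prems p 0 by (auto split: nat.split)
  moreover have "(\<Sum>j<Suc m. F (?\<tau> j) (?\<alpha> j) (?\<alpha> (Suc j))) = chain_sum F a (p # ps)"
    using m(3) p 0 by (simp add: sum.lessThan_Suc_shift del: sum.lessThan_Suc)
  ultimately show ?case by blast
qed

lemma fine_chain_of_partition:
  assumes "is_partition a b m \<alpha>"
    and "\<forall>j<m. \<tau> j \<in> {\<alpha> j..\<alpha> (Suc j)} \<and>
       {\<alpha> j..\<alpha> (Suc j)} \<subseteq> {\<tau> j - \<delta> (\<tau> j)<..<\<tau> j + \<delta> (\<tau> j)}"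
  shows "\<exists>ps. fine_chain \<delta> a b ps \<and> (\<Sum>j<m. F (\<tau> j) (\<alpha> j) (\<alpha> (Suc j))) = chain_sum F a ps"
  using assms
proof (induction m arbitrary: a \<alpha> \<tau>)
  case 0
  then show ?case by (intro exI[of _ "[]"]) (auto simp: is_partition_def)
next
  case (Suc m)
  have p: "is_partition (\<alpha> 1) b m (\<lambda>j. \<alpha> (Suc j))" using Suc.prems(1) by (auto simp: is_partition_def)
  obtain ps where ps: "fine_chain \<delta> (\<alpha> 1) b ps"
    "(\<Sum>j<m. F (\<tau> (Suc j)) (\<alpha> (Suc j)) (\<alpha> (Suc (Suc j)))) = chain_sum F (\<alpha> 1) ps"
    using Suc.IH[OF p, of "\<lambda>j. \<tau> (Suc j)"] Suc.prems(2) by auto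
  have a: "\<alpha> 0 = a" "\<alpha> 0 < \<alpha> 1" using Suc.prems(1) by (auto simp: is_partition_def)
  have "\<tau> 0 \<in> {\<alpha> 0..\<alpha> 1}" "{\<alpha> 0..\<alpha> 1} \<subseteq> {\<tau> 0 - \<delta> (\<tau> 0)<..<\<tau> 0 + \<delta> (\<tau> 0)}"
    using Suc.prems(2) by auto
  then have "fine_chain \<delta> a b ((\<tau> 0, \<alpha> 1) # ps)"
    using a ps(1) by (simp add: atLeastAtMost_subset_greaterThanLessThan_iff)
  moreover have "(\<Sum>j<Suc m. F (\<tau> j) (\<alpha> j) (\<alpha> (Suc j))) = chain_sum F a ((\<tau> 0, \<alpha> 1) # ps)"
    using ps(2) a(1) by (simp add: sum.lessThan_Suc_shift del: sum.lessThan_Suc)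
  ultimately show ?case by blast
qed

lemma has_ks_integral_pos_iff:
  "has_ks_integral_pos A g a b X \<longleftrightarrow> has_kint (stieltjes A g) a b X"
proof
  assume H: "has_ks_integral_pos A g a b X"
  show "has_kint (stieltjes A g) a b X"
    unfolding has_kint_iff_less
  proof (intro allI impI)
    fix \<epsilon> :: real
    assume "\<epsilon> > 0"
    obtain \<delta> where d: "(\<forall>t\<in>{a..b}. \<delta> t > 0) \<and>
      (\<forall>m \<alpha> \<tau>. is_partition a b m \<alpha> \<and>
           (\<forall>j<m. \<tau> j \<in> {\<alpha> j..\<alpha> (Suc j)} \<and>
                  {\<alpha> j..\<alpha> (Suc j)} \<subseteq> {\<tau> j - \<delta> (\<tau> j)<..<\<tau> j + \<delta> (\<tau> j)}) \<longrightarrow>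
           norm ((\<Sum>j<m. (A (\<alpha> (Suc j)) - A (\<alpha> j)) *v g (\<tau> j)) - X) < \<epsilon>)"
      using H[unfolded has_ks_integral_pos_def, rule_format, OF \<open>\<epsilon> > 0\<close>] ..
    \<comment> \<open>The given gauge is positive only on \<open>{a..b}\<close>; elsewhere it is
      replaced by 1, and fine chains of that interval do not see the change.\<close>
    define \<delta>' where "\<delta>' t = (if t \<in> {a..b} then \<delta> t else 1)" for t
    have "norm (chain_sum (stieltjes A g) a ps - X) < \<epsilon>" if "fine_chain \<delta>' a b ps" for ps
    proof -
      have "fine_chain \<delta> a b ps" by (rule fine_chain_mono_on[OF that]) (simp add: \<delta>'_def)
      from partition_of_fine_chain[OF this, of "stieltjes A g"] obtain m \<alpha> \<tau> where
        m: "is_partition a b m \<alpha>" "\<forall>j<m. \<tau> j \<in> {\<alpha> j..\<alpha> (Suc j)} \<and>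
                  {\<alpha> j..\<alpha> (Suc j)} \<subseteq> {\<tau> j - \<delta> (\<tau> j)<..<\<tau> j + \<delta> (\<tau> j)}"
        and eq: "(\<Sum>j<m. stieltjes A g (\<tau> j) (\<alpha> j) (\<alpha> (Suc j))) = chain_sum (stieltjes A g) a ps"
        by blast
      show ?thesis
        using conjunct2[OF d, rule_format, OF conjI[OF m]] eq by (simp add: stieltjes_def)
    qed
    moreover have "\<forall>t. \<delta>' t > 0" using conjunct1[OF d] by (simp add: \<delta>'_def)
    ultimately show "\<exists>\<delta>. (\<forall>t. \<delta> t > 0) \<and>
        (\<forall>ps. fine_chain \<delta> a b ps \<longrightarrow> norm (chain_sum (stieltjes A g) a ps - X) < \<epsilon>)" by blast
  qed
next
  assume H: "has_kint (stieltjes A g) a b X"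
  show "has_ks_integral_pos A g a b X"
    unfolding has_ks_integral_pos_def
  proof (intro allI impI)
    fix \<epsilon> :: real
    assume "\<epsilon> > 0"
    then obtain \<delta> where d: "\<forall>t. \<delta> t > 0"
      "\<And>ps. fine_chain \<delta> a b ps \<Longrightarrow> norm (chain_sum (stieltjes A g) a ps - X) < \<epsilon>"
      using H unfolding has_kint_iff_less by blast
    have "norm ((\<Sum>j<m. (A (\<alpha> (Suc j)) - A (\<alpha> j)) *v g (\<tau> j)) - X) < \<epsilon>"
      if m: "is_partition a b m \<alpha>" "\<forall>j<m. \<tau> j \<in> {\<alpha> j..\<alpha> (Suc j)} \<and>
                  {\<alpha> j..\<alpha> (Suc j)} \<subseteq> {\<tau> j - \<delta> (\<tau> j)<..<\<tau> j + \<delta> (\<tau> j)}" for m \<alpha> \<tau>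
    proof -
      obtain ps where ps: "fine_chain \<delta> a b ps"
        "(\<Sum>j<m. stieltjes A g (\<tau> j) (\<alpha> j) (\<alpha> (Suc j))) = chain_sum (stieltjes A g) a ps"
        using fine_chain_of_partition[OF m, of "stieltjes A g"] by blast
      show ?thesis using d(2)[OF ps(1)] ps(2) by (simp add: stieltjes_def)
    qed
    then show "\<exists>\<delta>. (\<forall>t\<in>{a..b}. \<delta> t > 0) \<and>
        (\<forall>m \<alpha> \<tau>. is_partition a b m \<alpha> \<and>
           (\<forall>j<m. \<tau> j \<in> {\<alpha> j..\<alpha> (Suc j)} \<and>
                  {\<alpha> j..\<alpha> (Suc j)} \<subseteq> {\<tau> j - \<delta> (\<tau> j)<..<\<tau> j + \<delta> (\<tau> j)}) \<longrightarrow>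
           norm ((\<Sum>j<m. (A (\<alpha> (Suc j)) - A (\<alpha> j)) *v g (\<tau> j)) - X) < \<epsilon>)"
      using d(1) by (intro exI[of _ \<delta>]) auto
  qed
qed

text \<open>The degenerate case \<open>a = b\<close> joins the first branch because the integral
  over a point can only be 0.\<close>

lemma has_ks_integral_iff:
  "has_ks_integral A g a b X \<longleftrightarrow>
    (if a \<le> b then has_kint (stieltjes A g) a b X else has_kint (stieltjes A g) b a (- X))"
  by (auto simp: has_ks_integral_def has_ks_integral_pos_iff has_kint_refl)

text \<open>Solved for the integral, the equation says that it is the increment of
  \<open>x - f\<close>. Exchanging \<open>s\<close> and \<open>t\<close> negates both sides, so
  ordered pairs \<open>s \<le> t\<close> are enough.\<close>

lemma glde_solution_iff:
  "glde_solution A f x \<longleftrightarrow> kprim (stieltjes A x) UNIV (\<lambda>t. x t - f t)"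
proof
  assume H: "glde_solution A f x"
  show "kprim (stieltjes A x) UNIV (\<lambda>t. x t - f t)"
    unfolding kprim_def
  proof (intro ballI impI)
    fix s t :: real
    assume "s \<le> t"
    obtain X where X: "has_ks_integral A x s t X" "x t = x s + X + f t - f s"
      using H unfolding glde_solution_def by blast
    have "X = x t - f t - (x s - f s)" using X(2) by simp
    then show "has_kint (stieltjes A x) s t (x t - f t - (x s - f s))"
      using X(1) \<open>s \<le> t\<close> unfolding has_ks_integral_iff by simp
  qed
next
  assume H: "kprim (stieltjes A x) UNIV (\<lambda>t. x t - f t)"
  show "glde_solution A f x"
    unfolding glde_solution_def
  proof (intro allI)
    fix s t
    let ?X = "x t - f t - (x s - f s)"
    have "has_ks_integral A x s t ?X"
      using H unfolding has_ks_integral_iff kprim_def by simp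
    then show "\<exists>X. has_ks_integral A x s t X \<and> x t = x s + X + f t - f s"
      by (intro exI[of _ ?X]) simp
  qed
qed

lemma column_mat_1: "column j (mat 1 :: real^'n^'n) = axis j 1"
  by (simp add: column_def mat_def axis_def vec_eq_iff)

lemma matrix_eq_columns: "M = N \<longleftrightarrow> (\<forall>j. column j M = column j N)"
  by (auto simp: column_def vec_eq_iff)

text \<open>Column by column, the integral equation describes the homogeneous solutions that start
  at time \<open>s\<close> from the standard basis vectors.\<close>

lemma is_transition_matrix_iff:
  "is_transition_matrix A U \<longleftrightarrow> (\<forall>s. U s s = mat 1) \<and>
     (\<forall>s j. kprim (stieltjes A (\<lambda>r. column j (U r s))) UNIV (\<lambda>r. column j (U r s)))"
  (is "_ \<longleftrightarrow> ?R")
proof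
  assume H: "is_transition_matrix A U"
  have ks: "has_ks_integral A (\<lambda>r. column j (U r s)) s t (column j (U t s) - axis j 1)" for s t j
  proof -
    obtain X where X: "has_ks_integral_matrix A (\<lambda>r. U r s) s t X" "U t s = mat 1 + X"
      using H unfolding is_transition_matrix_def by blast
    then have "column j (U t s) = axis j 1 + column j X"
      by (simp add: column_def mat_def axis_def vec_eq_iff)
    then show ?thesis using X(1) unfolding has_ks_integral_matrix_def by simp
  qed
  have "column j (U s s) = axis j 1" for s j
    using ks[of j s s] by (simp add: has_ks_integral_def)
  then have U: "U s s = mat 1" for s by (simp add: matrix_eq_columns[of "U s s"] column_mat_1)
  have "kprim (stieltjes A (\<lambda>r. column j (U r s))) UNIV (\<lambda>r. column j (U r s))" for s j
  proof (rule kprim_from_base[of s])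
    fix t
    show "has_kint (stieltjes A (\<lambda>r. column j (U r s))) s t (column j (U t s) - column j (U s s))"
      if "s \<le> t" using ks[of j s t] that by (simp add: has_ks_integral_iff U column_mat_1)
    show "has_kint (stieltjes A (\<lambda>r. column j (U r s))) t s (column j (U s s) - column j (U t s))"
      if "t \<le> s"
      using ks[of j s t] that
      by (cases "t = s") (simp_all add: has_kint_refl has_ks_integral_iff U column_mat_1)
  qed (auto intro: stieltjes_split)
  then show ?R using U by blast
next
  assume H: ?R
  have "has_ks_integral_matrix A (\<lambda>r. U r s) s t (U t s - mat 1)" for s t
    unfolding has_ks_integral_matrix_def
  proof
    fix j
    have K: "kprim (stieltjes A (\<lambda>r. column j (U r s))) UNIV (\<lambda>r. column j (U r s))"
      using H by blast
    have c: "column j (U t s - mat 1) = column j (U t s) - column j (U s s)"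
      using H by (simp add: column_def vec_eq_iff)
    show "has_ks_integral A (\<lambda>r. column j (U r s)) s t (column j (U t s - mat 1))"
      unfolding c has_ks_integral_iff using K unfolding kprim_def by simp
  qed
  then show "is_transition_matrix A U"
    unfolding is_transition_matrix_def by (metis add_diff_cancel_left' diff_add_cancel add.commute)
qed

section \<open>From the variation to a dominating function\<close>

lemma norm_matrix_vector_le_op_norm: "norm (M *v x) \<le> op_norm M * norm x"
  unfolding op_norm_def by (rule onorm) (rule matrix_vector_mul_bounded_linear)

lemma op_norm_nonneg: "0 \<le> op_norm M"
  unfolding op_norm_def by (rule onorm_pos_le) (rule matrix_vector_mul_bounded_linear)

lemma op_norm_zero [simp]: "op_norm (0 :: real^'n^'n) = 0"
  by (simp add: op_norm_def onorm_zero matrix_vector_mult_0[abs_def])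

lemma variation_nonneg:
  assumes "a \<le> b"
  shows "0 \<le> variation a b A"
proof -
  obtain m \<alpha> where m: "is_partition a b m \<alpha>"
    using partition_of_fine_chain[where F="\<lambda>_ _ _. 0 :: real"] fine_chain_exists[OF assms, of "\<lambda>_. 1"]
    by fastforce
  have "0 \<le> ereal (\<Sum>j<m. op_norm (A (\<alpha> (Suc j)) - A (\<alpha> j)))"
    by (simp add: sum_nonneg op_norm_nonneg)
  also have "\<dots> \<le> variation a b A"
    unfolding variation_def using m by (intro SUP_upper2[of "(m, \<alpha>)"]) auto
  finally show ?thesis .
qed

text \<open>A partition that ends at \<open>t\<close> gains the point \<open>u\<close> and one more
  term. Partitions are strictly increasing, so \<open>t = u\<close> is a case of its own.\<close>

lemma variation_append:
  assumes "t \<le> u"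
  shows "variation s t A + ereal (op_norm (A u - A t)) \<le> variation s u A"
proof (cases "t = u")
  case False
  let ?S = "{(m, \<alpha>). is_partition s t m \<alpha>}"
  let ?c = "ereal (op_norm (A u - A t))"
  have "variation s t A \<le> variation s u A - ?c"
    unfolding variation_def[of s t]
  proof (rule SUP_least, clarify)
    fix m \<alpha>
    assume m: "is_partition s t m \<alpha>"
    define \<beta> where "\<beta> j = (if j \<le> m then \<alpha> j else u)" for j
    have "is_partition s u (Suc m) \<beta>"
      using m False assms by (auto simp: is_partition_def \<beta>_def less_Suc_eq)
    then have "ereal (\<Sum>j<Suc m. op_norm (A (\<beta> (Suc j)) - A (\<beta> j))) \<le> variation s u A"
      unfolding variation_def by (intro SUP_upper2[of "(Suc m, \<beta>)"]) auto
    moreover have "(\<Sum>j<Suc m. op_norm (A (\<beta> (Suc j)) - A (\<beta> j))) =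
        (\<Sum>j<m. op_norm (A (\<alpha> (Suc j)) - A (\<alpha> j))) + op_norm (A u - A t)"
      using m by (simp add: \<beta>_def is_partition_def)
    ultimately show "ereal (\<Sum>j<m. op_norm (A (\<alpha> (Suc j)) - A (\<alpha> j))) \<le> variation s u A - ?c"
      by (simp add: ereal_le_minus)
  qed
  then show ?thesis by (simp add: ereal_le_minus)
qed (simp add: zero_ereal_def[symmetric])

lemma variation_prepend:
  assumes "s \<le> t"
  shows "variation t u A + ereal (op_norm (A t - A s)) \<le> variation s u A"
proof (cases "s = t")
  case False
  let ?c = "ereal (op_norm (A t - A s))"
  have "variation t u A \<le> variation s u A - ?c"
    unfolding variation_def[of t u]
  proof (rule SUP_least, clarify)
    fix m \<alpha>
    assume m: "is_partition t u m \<alpha>"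
    define \<beta> where "\<beta> = case_nat s \<alpha>"
    have "is_partition s u (Suc m) \<beta>"
      using m False assms by (auto simp: is_partition_def \<beta>_def split: nat.split)
    then have "ereal (\<Sum>j<Suc m. op_norm (A (\<beta> (Suc j)) - A (\<beta> j))) \<le> variation s u A"
      unfolding variation_def by (intro SUP_upper2[of "(Suc m, \<beta>)"]) auto
    moreover have "(\<Sum>j<Suc m. op_norm (A (\<beta> (Suc j)) - A (\<beta> j))) =
        (\<Sum>j<m. op_norm (A (\<alpha> (Suc j)) - A (\<alpha> j))) + op_norm (A t - A s)"
      using m by (simp add: \<beta>_def is_partition_def sum.lessThan_Suc_shift del: sum.lessThan_Suc)
    ultimately show "ereal (\<Sum>j<m. op_norm (A (\<alpha> (Suc j)) - A (\<alpha> j))) \<le> variation s u A - ?c"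
      by (simp add: ereal_le_minus)
  qed
  then show ?thesis by (simp add: ereal_le_minus)
qed (simp add: zero_ereal_def[symmetric])

text \<open>The dominating function is the signed variation measured from 0. Increments on either
  side of 0 are handled by appending or prepending a point; an increment across 0 is split
  there.\<close>

lemma bv_by_exists:
  fixes A :: "real \<Rightarrow> real^'n^'n"
  assumes "locally_bounded_variation A"
  shows "\<exists>V. bv_by A V"
proof -
  define W where "W s t = real_of_ereal (variation s t A)" for s t
  have W: "variation s t A = ereal (W s t)" if "s \<le> t" for s t
  proof -
    have "variation s t A < \<infinity>" using assms that unfolding locally_bounded_variation_def by blast
    then show ?thesis using variation_nonneg[OF that, of A] by (simp add: W_def ereal_real)
  qed
  have app: "op_norm (A u - A t) \<le> W s u - W s t" if "s \<le> t" "t \<le> u" for s t u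
    using variation_append[OF that(2), of s A] W[OF that(1)] W[of s u] that by simp
  have pre: "op_norm (A t - A s) \<le> W s u - W t u" if "s \<le> t" "t \<le> u" for s t u
    using variation_prepend[OF that(1), of u A] W[OF that(2)] W[of s u] that by simp
  define V where "V t = (if t \<ge> 0 then W 0 t else - W t 0)" for t
  have W0: "W 0 0 \<ge> 0" unfolding W_def using variation_nonneg[of 0 0 A] by (simp add: real_of_ereal_pos)
  have le: "norm ((A t - A s) *v x) \<le> (V t - V s) * norm x"
    if "s \<le> t" "op_norm (A t - A s) \<le> V t - V s" for s t x
    using norm_matrix_vector_le_op_norm[of "A t - A s" x] that(2)
    by (meson mult_right_mono norm_ge_zero order_trans)
  have "norm ((A t - A s) *v x) \<le> (V t - V s) * norm x" if "s \<le> t" for s t x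
  proof -
    consider "0 \<le> s" | "t < 0" | "s < 0" "0 \<le> t" by linarith
    then show ?thesis
    proof cases
      case 1
      then show ?thesis using le[OF that] app[OF 1 that] that by (simp add: V_def)
    next
      case 2
      then show ?thesis using le[OF that] pre[OF that, of 0] that by (simp add: V_def)
    next
      case 3
      have "norm ((A t - A s) *v x) \<le> norm ((A t - A 0) *v x) + norm ((A 0 - A s) *v x)"
        using norm_triangle_ineq[of "(A t - A 0) *v x" "(A 0 - A s) *v x"]
        by (simp add: matrix_vector_mult_diff_rdistrib)
      also have "\<dots> \<le> op_norm (A t - A 0) * norm x + op_norm (A 0 - A s) * norm x"
        by (intro add_mono norm_matrix_vector_le_op_norm)
      also have "\<dots> = (op_norm (A t - A 0) + op_norm (A 0 - A s)) * norm x"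
        by (simp add: algebra_simps)
      also have "\<dots> \<le> (V t - V s) * norm x"
        using app[of 0 0 t] pre[of s 0 0] 3 W0 by (intro mult_right_mono) (auto simp: V_def)
      finally show ?thesis .
    qed
  qed
  then show ?thesis unfolding bv_by_def by blast
qed

section \<open>Regulated functions\<close>

lemma regulated_on_subset:
  "regulated_on a b g \<Longrightarrow> a \<le> c \<Longrightarrow> d \<le> b \<Longrightarrow> regulated_on c d g"
  unfolding regulated_on_def by auto

lemma regulated_on_reflect:
  assumes "regulated_on a b g"
  shows "regulated_on (- b) (- a) (\<lambda>t. g (- t))"
  unfolding regulated_on_def
proof (intro conjI ballI)
  fix t
  show "\<exists>l. ((\<lambda>t. g (- t)) \<longlongrightarrow> l) (at_right t)" if "t \<in> {- b..<- a}"
  proof -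
    have "- t \<in> {a<..b}" using that by auto
    then show ?thesis
      using assms unfolding regulated_on_def filterlim_at_left_to_right by force
  qed
  show "\<exists>l. ((\<lambda>t. g (- t)) \<longlongrightarrow> l) (at_left t)" if "t \<in> {- b<..- a}"
  proof -
    have "- t \<in> {a..<b}" using that by auto
    then show ?thesis
      using assms unfolding regulated_on_def filterlim_at_left_to_right minus_minus by blast
  qed
qed

lemma regulated_on_add:
  fixes g h :: "real \<Rightarrow> 'a::real_normed_vector"
  shows "regulated_on a b g \<Longrightarrow> regulated_on a b h \<Longrightarrow> regulated_on a b (\<lambda>t. g t + h t)"
  unfolding regulated_on_def by (blast intro: tendsto_add)

lemma regulated_on_const [simp]: "regulated_on a b (\<lambda>_. c)"
  unfolding regulated_on_def by (blast intro: tendsto_const)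

text \<open>Near each point the function is bounded by its value there and by the norms of its
  one-sided limits plus 1; bisection turns these local bounds into a global one.\<close>

lemma regulated_on_bounded:
  fixes g :: "real \<Rightarrow> 'a::real_normed_vector"
  assumes "regulated_on a b g" "a \<le> b"
  shows "\<exists>M. \<forall>t\<in>{a..b}. norm (g t) \<le> M"
proof -
  let ?P = "\<lambda>u v. \<exists>M. \<forall>t. a \<le> t \<and> t \<le> b \<and> u \<le> t \<and> t \<le> v \<longrightarrow> norm (g t) \<le> M"
  have "?P a b"
  proof (rule Bolzano[OF assms(2), of ?P])
    fix u v w
    assume "?P u v" "?P v w"
    then obtain M N where "\<forall>t. a \<le> t \<and> t \<le> b \<and> u \<le> t \<and> t \<le> v \<longrightarrow> norm (g t) \<le> M"
      "\<forall>t. a \<le> t \<and> t \<le> b \<and> v \<le> t \<and> t \<le> w \<longrightarrow> norm (g t) \<le> N" by blast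
    then show "?P u w"
      by (intro exI[of _ "max M N"]) (metis le_max_iff_disj linear)
  next
    fix x
    assume x: "a \<le> x" "x \<le> b"
    have "\<exists>M d. d > 0 \<and> (\<forall>t. x < t \<and> t < x + d \<and> t \<le> b \<longrightarrow> norm (g t) \<le> M)"
    proof (cases "x < b")
      case True
      then obtain l where "(g \<longlongrightarrow> l) (at_right x)"
        using assms(1) x unfolding regulated_on_def by (meson atLeastLessThan_iff greaterThanAtMost_iff)
      then have "\<forall>\<^sub>F t in at_right x. norm (g t) < norm l + 1"
        by (intro order_tendstoD(2)[OF tendsto_norm]) auto
      then obtain c where "c > x" "\<forall>t>x. t < c \<longrightarrow> norm (g t) < norm l + 1"
        unfolding eventually_at_right_field by blast
      then show ?thesis by (intro exI[of _ "norm l + 1"] exI[of _ "c - x"]) (auto intro: less_imp_le)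
    next
      case False
      then show ?thesis by (intro exI[of _ 0] exI[of _ 1]) auto
    qed
    then obtain M d where M: "d > 0" "\<And>t. x < t \<Longrightarrow> t < x + d \<Longrightarrow> t \<le> b \<Longrightarrow> norm (g t) \<le> M" by blast
    have "\<exists>M d. d > 0 \<and> (\<forall>t. x - d < t \<and> t < x \<and> a \<le> t \<longrightarrow> norm (g t) \<le> M)"
    proof (cases "a < x")
      case True
      then obtain l where "(g \<longlongrightarrow> l) (at_left x)"
        using assms(1) x unfolding regulated_on_def by (meson atLeastLessThan_iff greaterThanAtMost_iff)
      then have "\<forall>\<^sub>F t in at_left x. norm (g t) < norm l + 1"
        by (intro order_tendstoD(2)[OF tendsto_norm]) auto
      then obtain c where "c < x" "\<forall>t>c. t < x \<longrightarrow> norm (g t) < norm l + 1"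
        unfolding eventually_at_left_field by blast
      then show ?thesis by (intro exI[of _ "norm l + 1"] exI[of _ "x - c"]) (auto intro: less_imp_le)
    next
      case False
      then show ?thesis by (intro exI[of _ 0] exI[of _ 1]) auto
    qed
    then obtain N e where N: "e > 0" "\<And>t. x - e < t \<Longrightarrow> t < x \<Longrightarrow> a \<le> t \<Longrightarrow> norm (g t) \<le> N" by blast
    have "?P u v" if uv: "u \<le> x \<and> x \<le> v \<and> v - u < min d e" for u v
      proof (intro exI[of _ "max (norm (g x)) (max M N)"] allI impI)
        fix t
        assume "a \<le> t \<and> t \<le> b \<and> u \<le> t \<and> t \<le> v"
        then show "norm (g t) \<le> max (norm (g x)) (max M N)"
          using M(2)[of t] N(2)[of t] uv by (cases t x rule: linorder_cases) auto
      qed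
    then show "\<exists>d>0. \<forall>u v. u \<le> x \<and> x \<le> v \<and> v - u < d \<longrightarrow> ?P u v"
      using M(1) N(1) by (intro exI[of _ "min d e"] conjI) auto
  qed
  then show ?thesis by (metis atLeastAtMost_iff)
qed

section \<open>Integrability of regulated functions\<close>

text \<open>Close to \<open>x\<close> on the right, \<open>g\<close> is within \<epsilon> of the
  function \<open>h\<close> that keeps the value \<open>g x\<close> and equals the right limit
  \<open>l\<close> afterwards. The integral of \<open>h\<close> is explicit, and replacing
  \<open>g\<close> by \<open>h\<close> costs at most \<epsilon> times the increment of
  \<open>V\<close>.\<close>

lemma kint_approx_stieltjes_right:
  fixes A :: "real \<Rightarrow> real^'n^'n"
  assumes V: "bv_by A V" and g: "(g \<longlongrightarrow> l) (at_right x)" and "\<epsilon> > 0"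
  shows "\<exists>d>0. \<forall>b. x \<le> b \<and> b < x + d \<longrightarrow> kint_approx (stieltjes A g) x b (\<epsilon> * (V b - V x + (b - x)))"
proof -
  obtain c where c: "c > x" "\<And>t. x < t \<Longrightarrow> t < c \<Longrightarrow> norm (g t - l) < \<epsilon>"
    using tendstoD[OF g \<open>\<epsilon> > 0\<close>] unfolding eventually_at_right_field dist_norm by blast
  obtain L where L: "(A \<longlongrightarrow> L) (at_right x)" using bv_by_right_limit[OF V] by blast
  have "kint_approx (stieltjes A g) x b (\<epsilon> * (V b - V x + (b - x)))" if b: "x \<le> b" "b < c" for b
  proof (cases "b = x")
    case True
    then show ?thesis
      unfolding kint_approx_def by (intro exI[of _ 0] exI[of _ "\<lambda>_. 1"]) auto
  next
    case False
    then have xb: "x < b" using b by simp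
    define h where "h t = (if t = x then g x else l)" for t
    have const: "has_kint (stieltjes A (\<lambda>_. l)) x b ((A b - A x) *v l)"
      unfolding has_kint_def
    proof (intro allI impI)
      fix e :: real
      assume "e > 0"
      have "chain_sum (stieltjes A (\<lambda>_. l)) x ps = (A b - A x) *v l" if "fine_chain \<delta> x b ps" for \<delta> ps
        using chain_sum_telescope[OF that, of "\<lambda>t. A t *v l"]
        by (simp add: stieltjes_def[abs_def] matrix_vector_mult_diff_rdistrib)
      then show "\<exists>\<delta>. (\<forall>t. \<delta> t > 0) \<and> (\<forall>ps. fine_chain \<delta> x b ps \<longrightarrow>
          norm (chain_sum (stieltjes A (\<lambda>_. l)) x ps - (A b - A x) *v l) \<le> e)"
        using \<open>e > 0\<close> by (intro exI[of _ "\<lambda>_. 1"]) auto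
    qed
    have lim: "((\<lambda>v. stieltjes A h x x v - stieltjes A (\<lambda>_. l) x x v) \<longlongrightarrow>
        (L - A x) *v (g x - l)) (at_right x)"
    proof -
      have "((\<lambda>v. (A v - A x) *v (g x - l)) \<longlongrightarrow> (L - A x) *v (g x - l)) (at_right x)"
        by (intro tendsto_matrix_vector_mult_left tendsto_diff L tendsto_const)
      then show ?thesis by (simp add: stieltjes_def h_def matrix_vector_mult_diff_distrib)
    qed
    \<comment> \<open>The constant \<open>l\<close> contributes the full increment of
      \<open>A\<close>; the deviation \<open>g x - l\<close> at the single point \<open>x\<close>
      contributes through the right jump of \<open>A\<close>.\<close>
    define X where "X = (A b - A x) *v l + (L - A x) *v (g x - l)"
    have kh: "has_kint (stieltjes A h) x b X"
      unfolding X_def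
      by (rule has_kint_change_left_end[where F="stieltjes A h", OF const xb _ lim]) (simp add: stieltjes_def h_def)
    \<comment> \<open>The summand \<open>b - x\<close> in the error leaves positive room for
      approximating the integral of \<open>h\<close> even where \<open>V\<close> is
      constant.\<close>
    have "\<epsilon> * (b - x) > 0" using \<open>\<epsilon> > 0\<close> xb by simp
    from has_kintE[OF kh this] obtain \<delta> where d: "\<And>t. \<delta> t > 0"
      "\<And>ps. fine_chain \<delta> x b ps \<Longrightarrow> norm (chain_sum (stieltjes A h) x ps - X) \<le> \<epsilon> * (b - x)"
      by blast
    have "norm (chain_sum (stieltjes A g) x ps - X) \<le> \<epsilon> * (V b - V x + (b - x))"
      if ps: "fine_chain \<delta> x b ps" for ps
    proof -
      have "norm (chain_sum (stieltjes A (\<lambda>r. g r - h r)) x ps) \<le> \<epsilon> * (V b - V x)"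
      proof (rule norm_chain_sum_stieltjes_le[OF V ps])
        show "norm (g t - h t) \<le> \<epsilon>" if "t \<in> {x..b}" for t
          using c(2)[of t] that b \<open>\<epsilon> > 0\<close> by (auto simp: h_def)
      qed
      moreover have "chain_sum (stieltjes A (\<lambda>r. g r - h r)) x ps =
          chain_sum (stieltjes A g) x ps - chain_sum (stieltjes A h) x ps"
        by (simp add: stieltjes_diff[abs_def] chain_sum_diff)
      ultimately show ?thesis
        using d(2)[OF ps] norm_triangle_ineq[of "chain_sum (stieltjes A g) x ps - chain_sum (stieltjes A h) x ps"
            "chain_sum (stieltjes A h) x ps - X"]
        by (simp add: algebra_simps)
    qed
    then show ?thesis using d(1) unfolding kint_approx_def by blast
  qed
  then show ?thesis using c(1) by (intro exI[of _ "c - x"]) auto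
qed

lemma stieltjes_reflect:
  "- stieltjes A g (- t) (- v) (- u) = stieltjes (\<lambda>t. A (- t)) (\<lambda>t. g (- t)) t u v"
  by (simp add: stieltjes_def algebra_simps)

lemma kint_approx_stieltjes_left:
  fixes A :: "real \<Rightarrow> real^'n^'n"
  assumes V: "bv_by A V" and g: "(g \<longlongrightarrow> l) (at_left x)" and "\<epsilon> > 0"
  shows "\<exists>d>0. \<forall>a. a \<le> x \<and> x - d < a \<longrightarrow> kint_approx (stieltjes A g) a x (\<epsilon> * (V x - V a + (x - a)))"
proof -
  have "((\<lambda>t. g (- t)) \<longlongrightarrow> l) (at_right (- x))" using g by (simp add: filterlim_at_left_to_right)
  from kint_approx_stieltjes_right[OF bv_by_reflect[OF V] this \<open>\<epsilon> > 0\<close>]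
  obtain d where d: "d > 0" and ap: "\<And>b. - x \<le> b \<Longrightarrow> b < - x + d \<Longrightarrow>
      kint_approx (stieltjes (\<lambda>t. A (- t)) (\<lambda>t. g (- t))) (- x) b (\<epsilon> * (- V (- b) - - V (- (- x)) + (b - - x)))"
    by blast
  have "kint_approx (stieltjes A g) a x (\<epsilon> * (V x - V a + (x - a)))" if "a \<le> x" "x - d < a" for a
    by (rule kint_approx_reflect) (use ap[of "- a"] that in \<open>simp add: stieltjes_reflect algebra_simps\<close>)
  then show ?thesis using d by blast
qed

text \<open>Local errors are measured by increments of \<open>W\<close>, which add up exactly under
  concatenation. Bisection therefore reaches the whole interval with error
  \<open>\<epsilon> * (W b - W a)\<close> and without loss from the number of pieces.\<close>

lemma regulated_has_kint:
  fixes A :: "real \<Rightarrow> real^'n^'n"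
  assumes V: "bv_by A V" and g: "regulated_on a b g" and "a \<le> b"
  shows "\<exists>X. has_kint (stieltjes A g) a b X"
proof (rule has_kint_if_kint_approx[OF _ \<open>a \<le> b\<close>])
  fix e :: real
  assume "e > 0"
  define W where "W t = V t + t" for t
  have W_diff: "W t - W s = V t - V s + (t - s)" for s t by (simp add: W_def)
  have Wab: "W b - W a \<ge> 0" using monoD[OF bv_by_mono[OF V] \<open>a \<le> b\<close>] \<open>a \<le> b\<close> by (simp add: W_def)
  \<comment> \<open>This normalisation makes the total error at most \<open>e\<close>; the added 1
    keeps the denominator positive.\<close>
  define \<epsilon> where "\<epsilon> = e / (W b - W a + 1)"
  have \<epsilon>: "\<epsilon> > 0" using \<open>e > 0\<close> Wab by (simp add: \<epsilon>_def)
  let ?P = "\<lambda>u v. a \<le> u \<longrightarrow> v \<le> b \<longrightarrow> kint_approx (stieltjes A g) u v (\<epsilon> * (W v - W u))"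
  have "?P a b"
  proof (rule Bolzano[OF \<open>a \<le> b\<close>, of ?P])
    fix u v w
    assume P: "?P u v" "?P v w" and uvw: "u \<le> v" "v \<le> w"
    show "?P u w"
    proof (intro impI)
      assume "a \<le> u" "w \<le> b"
      then have "kint_approx (stieltjes A g) u w (\<epsilon> * (W v - W u) + \<epsilon> * (W w - W v))"
        using P uvw by (intro kint_approx_combine[of _ u v _ w]) (auto intro: stieltjes_split)
      then show "kint_approx (stieltjes A g) u w (\<epsilon> * (W w - W u))" by (simp add: algebra_simps)
    qed
  next
    fix x
    assume x: "a \<le> x" "x \<le> b"
    have "\<exists>d>0. \<forall>v. x \<le> v \<and> v < x + d \<and> v \<le> b \<longrightarrow> kint_approx (stieltjes A g) x v (\<epsilon> * (W v - W x))"
    proof (cases "x < b")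
      case True
      then obtain l where "(g \<longlongrightarrow> l) (at_right x)"
        using g x unfolding regulated_on_def by (meson atLeastLessThan_iff)
      from kint_approx_stieltjes_right[OF V this \<epsilon>] show ?thesis
        unfolding W_diff by blast
    next
      case False
      then have "kint_approx (stieltjes A g) x v (\<epsilon> * (W v - W x))" if "x \<le> v" "v \<le> b" for v
        using that x unfolding kint_approx_def by (intro exI[of _ 0] exI[of _ "\<lambda>_. 1"]) auto
      then show ?thesis by (intro exI[of _ 1]) auto
    qed
    then obtain d1 where d1: "d1 > 0" "\<And>v. x \<le> v \<Longrightarrow> v < x + d1 \<Longrightarrow> v \<le> b \<Longrightarrow>
        kint_approx (stieltjes A g) x v (\<epsilon> * (W v - W x))" by blast
    have "\<exists>d>0. \<forall>u. u \<le> x \<and> x - d < u \<and> a \<le> u \<longrightarrow> kint_approx (stieltjes A g) u x (\<epsilon> * (W x - W u))"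
    proof (cases "a < x")
      case True
      then obtain l where "(g \<longlongrightarrow> l) (at_left x)"
        using g x unfolding regulated_on_def by (meson greaterThanAtMost_iff)
      from kint_approx_stieltjes_left[OF V this \<epsilon>] show ?thesis
        unfolding W_diff by blast
    next
      case False
      then have "kint_approx (stieltjes A g) u x (\<epsilon> * (W x - W u))" if "u \<le> x" "a \<le> u" for u
        using that x unfolding kint_approx_def by (intro exI[of _ 0] exI[of _ "\<lambda>_. 1"]) auto
      then show ?thesis by (intro exI[of _ 1]) auto
    qed
    then obtain d2 where d2: "d2 > 0" "\<And>u. u \<le> x \<Longrightarrow> x - d2 < u \<Longrightarrow> a \<le> u \<Longrightarrow>
        kint_approx (stieltjes A g) u x (\<epsilon> * (W x - W u))" by blast
    have "?P u v" if uv: "u \<le> x \<and> x \<le> v \<and> v - u < min d1 d2" for u v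
    proof (intro impI)
      assume "a \<le> u" "v \<le> b"
      then have "kint_approx (stieltjes A g) u v (\<epsilon> * (W x - W u) + \<epsilon> * (W v - W x))"
        using d1(2)[of v] d2(2)[of u] uv
        by (intro kint_approx_combine[of _ u x _ v]) (auto intro: stieltjes_split)
      then show "kint_approx (stieltjes A g) u v (\<epsilon> * (W v - W u))" by (simp add: algebra_simps)
    qed
    then show "\<exists>d>0. \<forall>u v. u \<le> x \<and> x \<le> v \<and> v - u < d \<longrightarrow> ?P u v"
      using d1(1) d2(1) by (intro exI[of _ "min d1 d2"] conjI) auto
  qed
  then have "kint_approx (stieltjes A g) a b (\<epsilon> * (W b - W a))" by simp
  moreover have "\<epsilon> * (W b - W a) \<le> e"
    using \<open>e > 0\<close> Wab by (simp add: \<epsilon>_def field_simps)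
  ultimately show "kint_approx (stieltjes A g) a b e" by (rule kint_approx_mono)
qed

lemma regulated_kprim:
  fixes A :: "real \<Rightarrow> real^'n^'n"
  assumes V: "bv_by A V" and g: "regulated_on a b g" and p: "p \<in> {a..b}"
  shows "\<exists>K. kprim (stieltjes A g) {a..b} K \<and> K p = 0"
proof -
  have "\<exists>X. has_kint (stieltjes A g) a t X" if "t \<in> {a..b}" for t
    using that by (intro regulated_has_kint[OF V regulated_on_subset[OF g]]) auto
  then obtain K where K: "\<And>t. t \<in> {a..b} \<Longrightarrow> has_kint (stieltjes A g) a t (K t)" by metis
  have "kprim (stieltjes A g) {a..b} K"
    unfolding kprim_def using K has_kint_diff_right by (metis atLeastAtMost_iff)
  then have "kprim (stieltjes A g) {a..b} (\<lambda>t. K t + - K p)" by (simp only: kprim_shift_value)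
  then show ?thesis by (intro exI[of _ "\<lambda>t. K t + - K p"]) simp
qed

section \<open>Uniqueness and existence for initial value problems\<close>

definition jumps_invertible :: "(real \<Rightarrow> real^'n^'n) \<Rightarrow> bool" where
  "jumps_invertible A \<longleftrightarrow>
    (\<forall>t. invertible (mat 1 - left_jump A t) \<and> invertible (mat 1 + right_jump A t))"

lemma bv_by_left_limit:
  fixes A :: "real \<Rightarrow> real^'n^'n"
  assumes "bv_by A V"
  shows "\<exists>L. (A \<longlongrightarrow> L) (at_left x)"
  using bv_by_right_limit[OF bv_by_reflect[OF assms], of "- x"] by (simp add: filterlim_at_left_to_right)

lemma right_jump_eq: "(A \<longlongrightarrow> L) (at_right x) \<Longrightarrow> right_jump A x = L - A x"
  unfolding right_jump_def by (simp add: tendsto_Lim)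

lemma left_jump_eq: "(A \<longlongrightarrow> L) (at_left x) \<Longrightarrow> left_jump A x = A x - L"
  unfolding left_jump_def by (simp add: tendsto_Lim)

text \<open>The right jump of the reflected function is minus the left jump of \<open>A\<close>, and
  conversely, so the two families of matrices change places.\<close>

lemma jumps_invertible_reflect:
  fixes A :: "real \<Rightarrow> real^'n^'n"
  assumes V: "bv_by A V" and J: "jumps_invertible A"
  shows "jumps_invertible (\<lambda>t. A (- t))"
  unfolding jumps_invertible_def
proof (intro allI conjI)
  fix t
  obtain L where L: "(A \<longlongrightarrow> L) (at_left (- t))" using bv_by_left_limit[OF V] by blast
  then have "((\<lambda>t. A (- t)) \<longlongrightarrow> L) (at_right t)" by (simp add: filterlim_at_left_to_right)
  then have "right_jump (\<lambda>t. A (- t)) t = - left_jump A (- t)"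
    by (simp add: right_jump_eq left_jump_eq[OF L])
  then show "invertible (mat 1 + right_jump (\<lambda>t. A (- t)) t)"
    using J unfolding jumps_invertible_def by simp
  obtain R where R: "(A \<longlongrightarrow> R) (at_right (- t))" using bv_by_right_limit[OF V] by blast
  then have "((\<lambda>t. A (- t)) \<longlongrightarrow> R) (at_left t)" by (simp add: filterlim_at_left_to_right)
  then have "left_jump (\<lambda>t. A (- t)) t = - right_jump A (- t)"
    by (simp add: left_jump_eq right_jump_eq[OF R])
  then show "invertible (mat 1 - left_jump (\<lambda>t. A (- t)) t)"
    using J unfolding jumps_invertible_def by simp
qed

text \<open>Near \<open>x\<close> a primitive moves like the single term with tag \<open>x\<close>,
  whose limit is the right jump of \<open>A\<close> applied to \<open>g x\<close>.\<close>

lemma kprim_stieltjes_right_limit: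
  fixes A :: "real \<Rightarrow> real^'n^'n"
  assumes "kprim (stieltjes A g) {x..b} K" "x < b" "(A \<longlongrightarrow> L) (at_right x)"
  shows "(K \<longlongrightarrow> K x + (L - A x) *v g x) (at_right x)"
proof -
  have "((\<lambda>t. K x + (A t - A x) *v g x) \<longlongrightarrow> K x + (L - A x) *v g x) (at_right x)"
    by (intro tendsto_add tendsto_matrix_vector_mult_left tendsto_diff assms(3) tendsto_const)
  from tendsto_add[OF this kprim_right_limit[OF assms(1,2)]]
  show ?thesis by (simp add: stieltjes_def)
qed

section \<open>Uniqueness\<close>

lemma invertible_mult_eq_0_iff:
  fixes M :: "real^'n^'n"
  assumes "invertible M"
  shows "M *v x = 0 \<longleftrightarrow> x = 0"
  by (metis assms invertible_def matrix_vector_mul_assoc matrix_vector_mul_lid matrix_vector_mult_0_right)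

lemma invertible_mult_surj:
  fixes M :: "real^'n^'n"
  assumes "invertible M"
  shows "\<exists>x. M *v x = y"
  by (metis assms invertible_def matrix_vector_mul_assoc matrix_vector_mul_lid)

text \<open>Since \<open>z x = 0\<close>, the jump of \<open>A\<close> at \<open>x\<close> is not
  felt and \<open>z\<close> tends to 0 from the right. On the open interval up to \<open>c\<close>
  the function \<open>V\<close> grows by at most 1/2, so integrating halves any bound on
  \<open>z\<close> there; repetition leaves only 0.\<close>

lemma homogeneous_zero_right:
  fixes A :: "real \<Rightarrow> real^'n^'n"
  assumes V: "bv_by A V" and z: "kprim (stieltjes A z) UNIV z" and "z x = 0"
  shows "\<exists>d>0. \<forall>t. x \<le> t \<and> t < x + d \<longrightarrow> z t = 0"
proof -
  obtain L where L: "(A \<longlongrightarrow> L) (at_right x)" using bv_by_right_limit[OF V] by blast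
  have zlim: "(z \<longlongrightarrow> 0) (at_right x)"
    using kprim_stieltjes_right_limit[OF kprim_subset[OF z] _ L, of "x + 1"] \<open>z x = 0\<close> by simp
  obtain Lv where Lv: "(V \<longlongrightarrow> Lv) (at_right x)" "\<And>t. t > x \<Longrightarrow> Lv \<le> V t"
    using mono_right_limit[OF bv_by_mono[OF V]] by blast
  have "\<forall>\<^sub>F t in at_right x. norm (z t) < 1 \<and> V t < Lv + 1 / 2"
    using order_tendstoD(2)[OF tendsto_norm[OF zlim], of 1] order_tendstoD(2)[OF Lv(1), of "Lv + 1 / 2"]
    by (simp add: eventually_conj_iff)
  then obtain c where c: "c > x" "\<And>t. x < t \<Longrightarrow> t < c \<Longrightarrow> norm (z t) < 1"
    "\<And>t. x < t \<Longrightarrow> t < c \<Longrightarrow> V t < Lv + 1 / 2"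
    unfolding eventually_at_right_field by blast
  have half: "\<forall>t. x < t \<and> t < c \<longrightarrow> norm (z t) \<le> (1 / 2) ^ n" for n
  proof (induction n)
    case 0
    then show ?case using c(2) by (auto intro: less_imp_le)
  next
    case (Suc n)
    show ?case
    proof (intro allI impI)
      fix t
      assume t: "x < t \<and> t < c"
      \<comment> \<open>The starting point \<open>s\<close> stays to the right of \<open>x\<close>,
        which keeps the jump at \<open>x\<close> out of \<open>V t - V s\<close>; afterwards
        \<open>s\<close> tends to \<open>x\<close>, where \<open>z\<close> has limit 0.\<close>
      have "norm (z t) - norm (z s) \<le> (1 / 2) ^ Suc n" if s: "x < s" "s < t" for s
      proof -
        have "norm (z t - z s) \<le> (1 / 2) ^ n * (V t - V s)"
          by (rule kprim_lipschitz[OF V kprim_subset[OF z]]) (use Suc s t in auto)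
        also have "\<dots> \<le> (1 / 2) ^ n * (1 / 2)"
          using c(3)[of t] Lv(2)[OF s(1)] t by (intro mult_left_mono) auto
        finally show ?thesis using norm_triangle_ineq2[of "z t" "z s"] by simp
      qed
      then have "\<forall>\<^sub>F s in at_right x. norm (z t) - norm (z s) \<le> (1 / 2) ^ Suc n"
        unfolding eventually_at_right_field using t by blast
      moreover have "((\<lambda>s. norm (z t) - norm (z s)) \<longlongrightarrow> norm (z t) - norm (0::real^'n)) (at_right x)"
        by (intro tendsto_diff tendsto_const tendsto_norm zlim)
      ultimately have "norm (z t) - norm (0::real^'n) \<le> (1 / 2) ^ Suc n"
        by (intro tendsto_upperbound) auto
      then show "norm (z t) \<le> (1 / 2) ^ Suc n" by simp
    qed
  qed
  have "z t = 0" if "x < t" "t < c" for t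
  proof -
    have "(\<lambda>n. (1 / 2 :: real) ^ n) \<longlonglongrightarrow> 0" by (rule LIMSEQ_realpow_zero) auto
    then have "norm (z t) \<le> 0"
      by (rule LIMSEQ_le_const) (use half that in blast)
    then show ?thesis by simp
  qed
  then show ?thesis using c(1) \<open>z x = 0\<close> by (intro exI[of _ "c - x"]) (auto simp: order.order_iff_strict)
qed

text \<open>The right limit of \<open>z\<close> is \<open>mat 1 + right_jump A x\<close> applied to
  \<open>z x\<close>, which is nonzero by invertibility.\<close>

lemma homogeneous_nonzero_right:
  fixes A :: "real \<Rightarrow> real^'n^'n"
  assumes V: "bv_by A V" and J: "jumps_invertible A" and z: "kprim (stieltjes A z) UNIV z"
    and "z x \<noteq> 0"
  shows "\<exists>d>0. \<forall>t. x \<le> t \<and> t < x + d \<longrightarrow> z t \<noteq> 0"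
proof -
  obtain L where L: "(A \<longlongrightarrow> L) (at_right x)" using bv_by_right_limit[OF V] by blast
  have "(z \<longlongrightarrow> z x + (L - A x) *v z x) (at_right x)"
    using kprim_stieltjes_right_limit[OF kprim_subset[OF z] _ L, of "x + 1"] by simp
  moreover have "z x + (L - A x) *v z x = (mat 1 + right_jump A x) *v z x"
    by (simp add: right_jump_eq[OF L] algebra_simps)
  moreover have "\<dots> \<noteq> 0"
    using J \<open>z x \<noteq> 0\<close> by (simp add: jumps_invertible_def invertible_mult_eq_0_iff)
  ultimately have "\<forall>\<^sub>F t in at_right x. z t \<noteq> 0" using tendsto_imp_eventually_ne by metis
  then obtain c where "c > x" "\<And>t. x < t \<Longrightarrow> t < c \<Longrightarrow> z t \<noteq> 0"
    unfolding eventually_at_right_field by blast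
  then show ?thesis
    using \<open>z x \<noteq> 0\<close> by (intro exI[of _ "c - x"]) (auto simp: order.order_iff_strict)
qed

text \<open>Near each point the zero set is either everything or empty, hence it is clopen.\<close>
lemma homogeneous_unique:
  fixes A :: "real \<Rightarrow> real^'n^'n"
  assumes V: "bv_by A V" and J: "jumps_invertible A" and z: "kprim (stieltjes A z) UNIV z"
    and "z p = 0"
  shows "z t = 0"
proof -
  have z': "kprim (stieltjes (\<lambda>t. A (- t)) (\<lambda>t. z (- t))) UNIV (\<lambda>t. z (- t))"
    using kprim_stieltjes_reflect[OF z] by simp
  note V' = bv_by_reflect[OF V] and J' = jumps_invertible_reflect[OF V J]
  have 1: "\<exists>e>0. \<forall>t. dist t x < e \<longrightarrow> z t = 0" if zx: "z x = 0" for x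
  proof -
    obtain d where d: "d > 0" "\<And>t. x \<le> t \<Longrightarrow> t < x + d \<Longrightarrow> z t = 0"
      using homogeneous_zero_right[OF V z zx] by blast
    obtain e where e: "e > 0" "\<And>t. - x \<le> t \<Longrightarrow> t < - x + e \<Longrightarrow> z (- t) = 0"
      using homogeneous_zero_right[OF V' z', of "- x"] zx by auto
    have "z t = 0" if "dist t x < min d e" for t
      using d(2)[of t] e(2)[of "- t"] that by (cases "x \<le> t") (auto simp: dist_real_def)
    then show ?thesis using d(1) e(1) by (intro exI[of _ "min d e"]) auto
  qed
  have 2: "\<exists>e>0. \<forall>t. dist t x < e \<longrightarrow> z t \<noteq> 0" if zx: "z x \<noteq> 0" for x
  proof -
    obtain d where d: "d > 0" "\<And>t. x \<le> t \<Longrightarrow> t < x + d \<Longrightarrow> z t \<noteq> 0"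
      using homogeneous_nonzero_right[OF V J z zx] by blast
    obtain e where e: "e > 0" "\<And>t. - x \<le> t \<Longrightarrow> t < - x + e \<Longrightarrow> z (- t) \<noteq> 0"
      using homogeneous_nonzero_right[OF V' J' z', of "- x"] zx by auto
    have "z t \<noteq> 0" if "dist t x < min d e" for t
      using d(2)[of t] e(2)[of "- t"] that by (cases "x \<le> t") (auto simp: dist_real_def)
    then show ?thesis using d(1) e(1) by (intro exI[of _ "min d e"]) auto
  qed
  have "open {t. z t = 0}" unfolding open_dist using 1 by blast
  moreover have "open (- {t. z t = 0})" unfolding open_dist using 2 by blast
  ultimately have "closed {t. z t = 0} \<and> open {t. z t = 0}" by (simp add: closed_def)
  then have "{t. z t = 0} = UNIV" using \<open>z p = 0\<close> by (simp only: clopen) blast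
  then show ?thesis by blast
qed

text \<open>The equation restricted to times in \<open>S\<close>, in the form of
  \<open>glde_solution_iff\<close>. Local solutions need it, since \<open>glde_solution\<close>
  speaks of the whole line.\<close>

definition solves :: "(real \<Rightarrow> real^'n^'n) \<Rightarrow> (real \<Rightarrow> real^'n) \<Rightarrow> real set \<Rightarrow> (real \<Rightarrow> real^'n) \<Rightarrow> bool" where
  "solves A f S y \<longleftrightarrow> kprim (stieltjes A y) S (\<lambda>t. y t - f t)"

lemma solves_unique:
  fixes A :: "real \<Rightarrow> real^'n^'n"
  assumes "bv_by A V" "jumps_invertible A" "solves A f UNIV x" "solves A f UNIV y" "x p = y p"
  shows "x = y"
proof
  fix t
  have "kprim (stieltjes A (\<lambda>t. x t - y t)) UNIV (\<lambda>t. x t - y t)"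
    using kprim_stieltjes_diff[OF assms(3,4)[unfolded solves_def]] by simp
  from homogeneous_unique[OF assms(1,2) this, of p] show "x t = y t" using assms(5) by simp
qed

text \<open>Neumann series: each term is the primitive, vanishing at \<open>p\<close>, of the
  preceding one, and the bound on \<open>V\<close> halves the sup norm at each step. Summed up, the
  series minus its first term is a primitive of the series, which is the equation.\<close>

lemma solves_if_small_variation:
  fixes A :: "real \<Rightarrow> real^'n^'n"
  assumes V: "bv_by A V" and f: "regulated_on c d f" and p: "p \<in> {c..d}" and small: "V d - V c \<le> 1 / 2"
  shows "\<exists>y. y p = x0 \<and> solves A f {c..d} y"
proof -
  define I where "I g = (SOME K. kprim (stieltjes A g) {c..d} K \<and> K p = 0)" for g
  have I: "kprim (stieltjes A g) {c..d} (I g) \<and> I g p = 0" if "regulated_on c d g" for g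
    unfolding I_def using someI_ex[OF regulated_kprim[OF V that p]] .
  \<comment> \<open>The initial term is \<open>f\<close> shifted so as to take the value
    \<open>x0\<close> at \<open>p\<close>; all later terms vanish at \<open>p\<close>, so the sum
    takes the value \<open>x0\<close> there.\<close>
  define y where "y k = (I ^^ k) (\<lambda>t. f t + (x0 - f p))" for k
  have y0: "y 0 = (\<lambda>t. f t + (x0 - f p))" and ySuc: "y (Suc k) = I (y k)" for k
    by (simp_all add: y_def)
  have mono: "V s \<le> V t" if "s \<le> t" for s t using monoD[OF bv_by_mono[OF V] that] .
  have reg0: "regulated_on c d (y 0)" unfolding y0 by (intro regulated_on_add f regulated_on_const)
  obtain M where M: "\<And>t. t \<in> {c..d} \<Longrightarrow> norm (y 0 t) \<le> M"
    using regulated_on_bounded[OF reg0] p by (meson atLeastAtMost_iff order_trans)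
  have y: "regulated_on c d (y k) \<and> (\<forall>t\<in>{c..d}. norm (y k t) \<le> M * (1 / 2) ^ k)" for k
  proof (induction k)
    case 0
    then show ?case using reg0 M by simp
  next
    case (Suc k)
    have K: "kprim (stieltjes A (y k)) {c..d} (y (Suc k))" "y (Suc k) p = 0"
      using I Suc ySuc by auto
    have lip: "norm (y (Suc k) t - y (Suc k) s) \<le> M * (1 / 2) ^ k * (V t - V s)"
      if "c \<le> s" "s \<le> t" "t \<le> d" for s t
      by (rule kprim_lipschitz[OF V K(1)]) (use Suc that in auto)
    have "norm (y (Suc k) t) \<le> M * (1 / 2) ^ Suc k" if t: "t \<in> {c..d}" for t
    proof -
      have M0: "0 \<le> M * (1 / 2) ^ k" using Suc t norm_ge_zero order_trans by blast
      have "norm (y (Suc k) t) \<le> M * (1 / 2) ^ k * \<bar>V t - V p\<bar>"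
        using lip[of p t] lip[of t p] mono[of p t] mono[of t p] K(2) p t by (cases "p \<le> t") auto
      also have "\<bar>V t - V p\<bar> \<le> 1 / 2"
        using mono[of c t] mono[of t d] mono[of c p] mono[of p d] small p t
        unfolding atLeastAtMost_iff by linarith
      finally show ?thesis using M0 by (simp add: mult_left_mono)
    qed
    then show ?case
      using regulated_on_if_dominated[OF bv_by_mono[OF V] lip] by blast
  qed
  have yK: "kprim (stieltjes A (y k)) {c..d} (y (Suc k))" "y (Suc k) p = 0" for k
    using I y ySuc by auto
  define Y where "Y t = (\<Sum>k. y k t)" for t
  have geo: "summable (\<lambda>k. M * (1 / 2) ^ k)" by (intro summable_mult summable_geometric) auto
  have sm: "summable (\<lambda>k. y k t)" if "t \<in> {c..d}" for t
    by (rule summable_comparison_test'[OF geo, of 0]) (use y that in auto)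
  \<comment> \<open>The 2 is the sum of the geometric series with ratio 1/2. The bound is uniform in
    \<open>t\<close>, as the passage to the limit under the integral requires.\<close>
  have tail: "norm ((\<Sum>k<n. y k t) - Y t) \<le> 2 * M * (1 / 2) ^ n" if t: "t \<in> {c..d}" for n t
  proof -
    have "norm ((\<Sum>k<n. y k t) - Y t) = norm (\<Sum>k. y (k + n) t)"
      using suminf_minus_initial_segment[OF sm[OF t], of n] by (simp add: Y_def norm_minus_commute)
    also have "\<dots> \<le> (\<Sum>k. M * (1 / 2) ^ n * (1 / 2) ^ k)"
    proof (rule norm_suminf_le)
      show "norm (y (k + n) t) \<le> M * (1 / 2) ^ n * (1 / 2) ^ k" for k
        using y[of "k + n"] t by (simp add: power_add mult_ac)
    qed (intro summable_mult summable_geometric, simp)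
    also have "\<dots> = 2 * M * (1 / 2) ^ n"
      by (subst suminf_mult) (auto simp: suminf_geometric summable_geometric)
    finally show ?thesis .
  qed
  have "kprim (stieltjes A Y) {c..d} (\<lambda>t. Y t - y 0 t)"
    unfolding kprim_def
  proof (intro ballI impI)
    fix s t
    assume st: "s \<in> {c..d}" "t \<in> {c..d}" "s \<le> t"
    show "has_kint (stieltjes A Y) s t (Y t - y 0 t - (Y s - y 0 s))"
    proof (rule has_kint_limit)
      show "has_kint (stieltjes A (\<lambda>r. \<Sum>k<n. y k r)) s t
          ((\<Sum>k<n. y (Suc k) t) - (\<Sum>k<n. y (Suc k) s))" for n
        using kprim_stieltjes_sum[of "{..<n}" A y "{c..d}" "\<lambda>k. y (Suc k)"] yK(1) st
        unfolding kprim_def by blast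
      show "norm (chain_sum (stieltjes A (\<lambda>r. \<Sum>k<n. y k r)) s ps - chain_sum (stieltjes A Y) s ps)
          \<le> 2 * M * (1 / 2) ^ n * (V t - V s)" if "fine_chain \<delta> s t ps" for n \<delta> ps
      proof -
        have "norm (chain_sum (stieltjes A (\<lambda>r. (\<Sum>k<n. y k r) - Y r)) s ps)
            \<le> 2 * M * (1 / 2) ^ n * (V t - V s)"
          by (rule norm_chain_sum_stieltjes_le[OF V that]) (use tail st in auto)
        then show ?thesis by (simp add: stieltjes_diff[abs_def] chain_sum_diff)
      qed
      have "(\<lambda>n. 2 * M * (1 / 2) ^ n * (V t - V s)) \<longlonglongrightarrow> 2 * M * 0 * (V t - V s)"
        by (intro tendsto_mult tendsto_const LIMSEQ_realpow_zero) auto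
      then show "(\<lambda>n. 2 * M * (1 / 2) ^ n * (V t - V s)) \<longlonglongrightarrow> 0" by simp
      have "(\<lambda>n. \<Sum>k<n. y (Suc k) r) \<longlonglongrightarrow> Y r - y 0 r" if "r \<in> {c..d}" for r
        unfolding Y_def suminf_split_head[OF sm[OF that], symmetric]
        by (rule summable_LIMSEQ) (rule summable_Suc_iff[THEN iffD2, OF sm[OF that]])
      then show "(\<lambda>n. (\<Sum>k<n. y (Suc k) t) - (\<Sum>k<n. y (Suc k) s)) \<longlonglongrightarrow> Y t - y 0 t - (Y s - y 0 s)"
        using st by (intro tendsto_diff) auto
    qed
  qed
  then have "kprim (stieltjes A Y) {c..d} (\<lambda>t. (Y t - y 0 t) + (x0 - f p))" by (simp only: kprim_shift_value)
  then have "solves A f {c..d} Y" unfolding solves_def y0 by (simp add: algebra_simps)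
  moreover have "Y p = x0"
    using suminf_split_head[OF sm[OF p]] yK(2) by (simp add: Y_def y0)
  ultimately show ?thesis by blast
qed

section \<open>Existence on intervals and on the line\<close>

lemma solves_glue:
  fixes A :: "real \<Rightarrow> real^'n^'n"
  assumes y: "solves A f {a..b} y" and z: "solves A f {b..c} z" and "y b = z b" "a \<le> b" "b \<le> c"
  shows "\<exists>w. solves A f {a..c} w \<and> (\<forall>t\<in>{a..b}. w t = y t) \<and> (\<forall>t\<in>{b..c}. w t = z t)"
proof -
  define w where "w t = (if t \<le> b then y t else z t)" for t
  have w: "w t = y t" if "t \<in> {a..b}" for t using that by (simp add: w_def)
  have w': "w t = z t" if "t \<in> {b..c}" for t using that \<open>y b = z b\<close> by (auto simp: w_def)
  have "kprim (stieltjes A w) {a..b} (\<lambda>t. w t - f t)"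
    by (rule kprim_cong[OF y[unfolded solves_def]]) (auto simp: w stieltjes_def)
  moreover have "kprim (stieltjes A w) {b..c} (\<lambda>t. w t - f t)"
    by (rule kprim_cong[OF z[unfolded solves_def]]) (auto simp: w' stieltjes_def)
  ultimately have "solves A f {a..c} w" unfolding solves_def by (rule kprim_stieltjes_combine)
  then show ?thesis using w w' by blast
qed

lemma solves_singleton: "solves A f {a..a} y"
  by (simp add: solves_def kprim_def has_kint_refl)

lemma solves_reflect:
  "solves A f {a..b} y \<Longrightarrow> solves (\<lambda>t. A (- t)) (\<lambda>t. f (- t)) {- b..- a} (\<lambda>t. y (- t))"
  unfolding solves_def using kprim_stieltjes_reflect[of A y "{a..b}" "\<lambda>t. y t - f t"] by simp

text \<open>The value may be prescribed at either end. Concatenation uses this to continue a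
  solution to the right or to the left, and time reversal exchanges the two halves.\<close>

definition solvable :: "(real \<Rightarrow> real^'n^'n) \<Rightarrow> (real \<Rightarrow> real^'n) \<Rightarrow> real \<Rightarrow> real \<Rightarrow> bool" where
  "solvable A f a b \<longleftrightarrow> (\<forall>x0. (\<exists>y. y a = x0 \<and> solves A f {a..b} y) \<and>
     (\<exists>y. y b = x0 \<and> solves A f {a..b} y))"

lemma solvable_refl: "solvable A f a a"
  unfolding solvable_def
proof
  fix x0
  have "\<exists>y. y a = x0 \<and> solves A f {a..a} y"
    by (intro exI[of _ "\<lambda>_. x0"] conjI solves_singleton) simp
  then show "(\<exists>y. y a = x0 \<and> solves A f {a..a} y) \<and> (\<exists>y. y a = x0 \<and> solves A f {a..a} y)" by blast
qed

lemma solvable_trans: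
  fixes A :: "real \<Rightarrow> real^'n^'n"
  assumes 1: "solvable A f a b" and 2: "solvable A f b c" and "a \<le> b" "b \<le> c"
  shows "solvable A f a c"
  unfolding solvable_def
proof (intro allI conjI)
  fix x0
  obtain y where y: "y a = x0" "solves A f {a..b} y" using 1 unfolding solvable_def by blast
  obtain z where z: "z b = y b" "solves A f {b..c} z" using 2 unfolding solvable_def by blast
  show "\<exists>y. y a = x0 \<and> solves A f {a..c} y"
    using solves_glue[OF y(2) z(2) z(1)[symmetric] assms(3,4)] y(1) assms(3) by fastforce
  obtain z where z: "z c = x0" "solves A f {b..c} z" using 2 unfolding solvable_def by blast
  obtain y where y: "y b = z b" "solves A f {a..b} y" using 1 unfolding solvable_def by blast
  show "\<exists>y. y c = x0 \<and> solves A f {a..c} y"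
    using solves_glue[OF y(2) z(2) y(1) assms(3,4)] z(1) assms(4) by fastforce
qed

lemma solvable_reflect:
  fixes A :: "real \<Rightarrow> real^'n^'n"
  assumes "solvable (\<lambda>t. A (- t)) (\<lambda>t. f (- t)) (- b) (- a)"
  shows "solvable A f a b"
  unfolding solvable_def
proof (intro allI conjI)
  fix x0
  obtain y where y: "y (- a) = x0" "solves (\<lambda>t. A (- t)) (\<lambda>t. f (- t)) {- b..- a} y"
    using assms unfolding solvable_def by blast
  show "\<exists>y. y a = x0 \<and> solves A f {a..b} y"
    using solves_reflect[OF y(2)] y(1) by (intro exI[of _ "\<lambda>t. y (- t)"]) simp
  obtain y where y: "y (- b) = x0" "solves (\<lambda>t. A (- t)) (\<lambda>t. f (- t)) {- b..- a} y"
    using assms unfolding solvable_def by blast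
  show "\<exists>y. y b = x0 \<and> solves A f {a..b} y"
    using solves_reflect[OF y(2)] y(1) by (intro exI[of _ "\<lambda>t. y (- t)"]) simp
qed

text \<open>
  Replacing the values at \<open>x\<close> of \<open>A\<close>, \<open>f\<close> and the solution by the right limits removes the
  jump at \<open>x\<close>, so that \<open>A\<close> has small variation on a right neighbourhood of \<open>x\<close>.
\<close>
lemma solves_change_left_end:
  fixes A :: "real \<Rightarrow> real^'n^'n"
  assumes L: "(A \<longlongrightarrow> L) (at_right x)"
    and y: "solves (A(x := L)) (f(x := fl)) {x..b} y"
    and w: "y x = w + (L - A x) *v w + fl - f x"
  shows "solves A f {x..b} (y(x := w))"
  unfolding solves_def kprim_def
proof (intro ballI impI)
  fix s t
  assume st: "s \<in> {x..b}" "t \<in> {x..b}" "s \<le> t"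
  let ?F = "stieltjes A (y(x := w))" and ?G = "stieltjes (A(x := L)) y"
  have G: "has_kint ?G s t (y t - (f(x := fl)) t - (y s - (f(x := fl)) s))"
    using y st unfolding solves_def kprim_def by blast
  consider "s = t" | "x < s" | "s = x" "x < t" using st by force
  then show "has_kint ?F s t ((y(x := w)) t - f t - ((y(x := w)) s - f s))"
  proof cases
    case 1
    then show ?thesis by (simp add: has_kint_refl)
  next
    case 2
    have "has_kint ?F s t (y t - (f(x := fl)) t - (y s - (f(x := fl)) s))"
      by (rule has_kint_cong[OF G]) (use 2 in \<open>auto simp: stieltjes_def\<close>)
    then show ?thesis using 2 st by simp
  next
    case 3
    \<comment> \<open>With tag \<open>x\<close>, the original data contribute
      \<open>(A v - A x) *v w\<close> and the modified data \<open>(A v - L) *v y x\<close>. The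
      latter vanishes in the limit, so the difference is the jump term.\<close>
    have lim: "((\<lambda>v. ?F x x v - ?G x x v) \<longlongrightarrow> (L - A x) *v w) (at_right x)"
    proof -
      have "((\<lambda>v. (A v - A x) *v w - (A v - L) *v y x) \<longlongrightarrow> (L - A x) *v w - (L - L) *v y x) (at_right x)"
        by (intro tendsto_matrix_vector_mult_left tendsto_diff L tendsto_const)
      moreover have "\<forall>\<^sub>F v in at_right x. (A v - A x) *v w - (A v - L) *v y x = ?F x x v - ?G x x v"
        unfolding eventually_at_right_field by (intro exI[of _ "x + 1"]) (auto simp: stieltjes_def)
      ultimately show ?thesis by (simp add: filterlim_cong)
    qed
    have eq: "?F r u v = ?G r u v" if "x < u" "u \<le> r" "r \<le> v" for r u v
      using that by (simp add: stieltjes_def)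
    have "has_kint ?F x t ((y t - (f(x := fl)) t - (y x - (f(x := fl)) x)) + (L - A x) *v w)"
      using has_kint_change_left_end[of ?G x t _ ?F, OF _ 3(2) _ lim] G 3(1) eq by blast
    then show ?thesis using 3 w by (simp add: algebra_simps)
  qed
qed

text \<open>Increments into or out of the new value at \<open>x\<close> are limits of increments
  whose endpoint approaches \<open>x\<close> from the right, and the inequality passes to the
  limit.\<close>

lemma bv_by_change_value:
  fixes A :: "real \<Rightarrow> real^'n^'n"
  assumes V: "bv_by A V" and L: "(A \<longlongrightarrow> L) (at_right x)" and Lv: "(V \<longlongrightarrow> Lv) (at_right x)"
  shows "bv_by (A(x := L)) (V(x := Lv))"
proof -
  have left: "norm ((L - A s) *v v) \<le> (Lv - V s) * norm v" if "s < x" for s v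
  proof (rule tendsto_le)
    show "((\<lambda>t. (V t - V s) * norm v) \<longlongrightarrow> (Lv - V s) * norm v) (at_right x)"
      by (intro tendsto_mult tendsto_diff Lv tendsto_const)
    show "((\<lambda>t. norm ((A t - A s) *v v)) \<longlongrightarrow> norm ((L - A s) *v v)) (at_right x)"
      by (intro tendsto_norm tendsto_matrix_vector_mult_left tendsto_diff L tendsto_const)
    show "\<forall>\<^sub>F t in at_right x. norm ((A t - A s) *v v) \<le> (V t - V s) * norm v"
      unfolding eventually_at_right_field using that bv_byD[OF V, of s]
      by (intro exI[of _ "x + 1"]) auto
  qed simp
  have right: "norm ((A t - L) *v v) \<le> (V t - Lv) * norm v" if "x < t" for t v
  proof (rule tendsto_le)
    show "((\<lambda>s. (V t - V s) * norm v) \<longlongrightarrow> (V t - Lv) * norm v) (at_right x)"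
      by (intro tendsto_mult tendsto_diff Lv tendsto_const)
    show "((\<lambda>s. norm ((A t - A s) *v v)) \<longlongrightarrow> norm ((A t - L) *v v)) (at_right x)"
      by (intro tendsto_norm tendsto_matrix_vector_mult_left tendsto_diff L tendsto_const)
    show "\<forall>\<^sub>F s in at_right x. norm ((A t - A s) *v v) \<le> (V t - V s) * norm v"
      unfolding eventually_at_right_field using that bv_byD[OF V, of _ t]
      by (intro exI[of _ t]) auto
  qed simp
  show ?thesis
    unfolding bv_by_def
  proof (intro allI impI)
    fix s t :: real and v :: "real^'n"
    assume "s \<le> t"
    then consider "s = t" | "s < t" "s = x" | "s < t" "t = x" | "s < t" "s \<noteq> x" "t \<noteq> x" by force
    then show "norm (((A(x := L)) t - (A(x := L)) s) *v v) \<le> ((V(x := Lv)) t - (V(x := Lv)) s) * norm v"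
      by cases (use left right bv_byD[OF V, of s t v] in auto)
  qed
qed

lemma regulated_on_change_value:
  assumes "regulated_on a b f"
  shows "regulated_on a b (f(x := c))"
proof -
  have "\<forall>\<^sub>F s in at t within S. (f(x := c)) s = f s" if "t = x \<or> t \<noteq> x" for t S
  proof -
    have "\<forall>\<^sub>F s in at t within S. s \<noteq> x" by (rule eventually_neq_at_within)
    then show ?thesis by eventually_elim simp
  qed
  then have "((f(x := c)) \<longlongrightarrow> l) (at t within S) \<longleftrightarrow> (f \<longlongrightarrow> l) (at t within S)" for l t S
    by (intro filterlim_cong) auto
  then show ?thesis using assms unfolding regulated_on_def by simp
qed

text \<open>The data modified at \<open>x\<close> are covered by the Neumann series, and the
  original value is restored afterwards. A value prescribed at \<open>x\<close> is pushed forward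
  through the jump; one prescribed at \<open>b\<close> has to be pulled back through it, which is
  where invertibility of \<open>mat 1 + right_jump A x\<close> enters.\<close>

lemma solvable_right:
  fixes A :: "real \<Rightarrow> real^'n^'n"
  assumes V: "bv_by A V" and J: "jumps_invertible A" and f: "\<And>a b. regulated_on a b f"
  shows "\<exists>d>0. \<forall>b. x \<le> b \<and> b < x + d \<longrightarrow> solvable A f x b"
proof -
  obtain L where L: "(A \<longlongrightarrow> L) (at_right x)" using bv_by_right_limit[OF V] by blast
  obtain Lv where Lv: "(V \<longlongrightarrow> Lv) (at_right x)"
    using mono_right_limit[OF bv_by_mono[OF V]] by blast
  obtain fl where fl: "(f \<longlongrightarrow> fl) (at_right x)"
    using f[of x "x + 1"] unfolding regulated_on_def by force
  have "\<forall>\<^sub>F t in at_right x. V t < Lv + 1 / 2" using order_tendstoD(2)[OF Lv] by simp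
  then obtain c where c: "c > x" "\<And>t. x < t \<Longrightarrow> t < c \<Longrightarrow> V t < Lv + 1 / 2"
    unfolding eventually_at_right_field by blast
  have "solvable A f x b" if b: "x < b" "b < c" for b
  proof -
    \<comment> \<open>Starting \<open>V\<close> from its right limit \<open>Lv\<close> at
      \<open>x\<close> leaves only the growth beyond the jump.\<close>
    have small: "(V(x := Lv)) b - (V(x := Lv)) x \<le> 1 / 2" using c(2)[OF b] b by simp
    have ex: "\<exists>y. y q = x0 \<and> solves (A(x := L)) (f(x := fl)) {x..b} y" if "q \<in> {x..b}" for q x0
      by (rule solves_if_small_variation[OF bv_by_change_value[OF V L Lv]
            regulated_on_change_value[OF f] that small])
    show ?thesis
      unfolding solvable_def
    proof (intro allI conjI)
      fix x0
      \<comment> \<open>This is the right limit at \<open>x\<close> that the equation dictates for a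
        solution with value \<open>x0\<close> at \<open>x\<close>.\<close>
      obtain y where "y x = x0 + (L - A x) *v x0 + fl - f x"
        "solves (A(x := L)) (f(x := fl)) {x..b} y"
        using ex[of x] b by auto
      from solves_change_left_end[OF L this(2,1)] show "\<exists>y. y x = x0 \<and> solves A f {x..b} y"
        by (intro exI[of _ "y(x := x0)"]) simp
      obtain y where y: "y b = x0" "solves (A(x := L)) (f(x := fl)) {x..b} y"
        using ex[of b] b by auto
      \<comment> \<open>\<open>w\<close> is the value at \<open>x\<close> whose passage through the
        jumps of \<open>A\<close> and \<open>f\<close> produces \<open>y x\<close>.\<close>
      obtain w where "(mat 1 + right_jump A x) *v w = y x - fl + f x"
        using J invertible_mult_surj unfolding jumps_invertible_def by blast
      then have "y x = w + (L - A x) *v w + fl - f x"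
        by (simp add: right_jump_eq[OF L] algebra_simps)
      from solves_change_left_end[OF L y(2) this] show "\<exists>y. y b = x0 \<and> solves A f {x..b} y"
        using y(1) b by (intro exI[of _ "y(x := w)"]) simp
    qed
  qed
  then have "solvable A f x b" if "x \<le> b" "b < c" for b
    using that solvable_refl by (cases "b = x") auto
  then show ?thesis using c(1) by (intro exI[of _ "c - x"]) auto
qed

text \<open>Every point has a two-sided neighbourhood on which the problem is solvable, the left
  half coming from time reversal; concatenation and bisection do the rest.\<close>

lemma solvable_all:
  fixes A :: "real \<Rightarrow> real^'n^'n"
  assumes V: "bv_by A V" and J: "jumps_invertible A" and f: "\<And>a b. regulated_on a b f" and "a \<le> b"
  shows "solvable A f a b"
proof (rule Bolzano[OF \<open>a \<le> b\<close>])
  fix x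
  obtain d where d: "d > 0" "\<And>b. x \<le> b \<Longrightarrow> b < x + d \<Longrightarrow> solvable A f x b"
    using solvable_right[OF V J f] by blast
  have f': "regulated_on a b (\<lambda>t. f (- t))" for a b
    using regulated_on_reflect[OF f[of "- b" "- a"]] by simp
  obtain e where e: "e > 0"
    "\<And>b. - x \<le> b \<Longrightarrow> b < - x + e \<Longrightarrow> solvable (\<lambda>t. A (- t)) (\<lambda>t. f (- t)) (- x) b"
    using solvable_right[OF bv_by_reflect[OF V] jumps_invertible_reflect[OF V J] f', of "- x"] by blast
  have "solvable A f u v" if "u \<le> x \<and> x \<le> v \<and> v - u < min d e" for u v
    by (rule solvable_trans[of A f u x v, OF solvable_reflect]) (use d(2)[of v] e(2)[of "- u"] that in auto)
  then show "\<exists>d>0. \<forall>u v. u \<le> x \<and> x \<le> v \<and> v - u < d \<longrightarrow> solvable A f u v"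
    using d(1) e(1) by (intro exI[of _ "min d e"] conjI) auto
qed (rule solvable_trans)

text \<open>A solution on the interval of radius \<open>n\<close> around \<open>p\<close> is
  continued by 1 on both sides without changing it. The resulting sequence is compatible and defines
  a solution on the line.\<close>

lemma solves_UNIV_exists:
  fixes A :: "real \<Rightarrow> real^'n^'n"
  assumes V: "bv_by A V" and J: "jumps_invertible A" and f: "\<And>a b. regulated_on a b f"
  shows "\<exists>y. y p = x0 \<and> solves A f UNIV y"
proof -
  define I where "I n = {p - real n..p + real n}" for n
  have ext: "\<exists>w. (w p = x0 \<and> solves A f (I (Suc n)) w) \<and> (\<forall>t\<in>I n. w t = y t)"
    if yn: "y p = x0 \<and> solves A f (I n) y" for y n
  proof -
    note ex = solvable_all[OF V J f, unfolded solvable_def]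
    obtain z where z: "z (p + real n) = y (p + real n)" "solves A f {p + real n..p + real (Suc n)} z"
      using ex[of "p + real n" "p + real (Suc n)"] by auto
    obtain w where w: "solves A f {p - real n..p + real (Suc n)} w" "\<forall>t\<in>I n. w t = y t"
      using solves_glue[where y = y and a = "p - real n", OF _ z(2) z(1)[symmetric]] yn
      unfolding I_def by auto
    obtain z' where z': "z' (p - real n) = w (p - real n)" "solves A f {p - real (Suc n)..p - real n} z'"
      using ex[of "p - real (Suc n)" "p - real n"] by auto
    obtain w' where w': "solves A f (I (Suc n)) w'" "\<forall>t\<in>{p - real n..p + real (Suc n)}. w' t = w t"
      using solves_glue[OF z'(2) w(1) z'(1)] unfolding I_def by auto
    have "\<forall>t\<in>I n. w' t = y t" using w(2) w'(2) by (auto simp: I_def)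
    moreover have "p \<in> I n" by (simp add: I_def)
    ultimately show ?thesis using w'(1) yn by metis
  qed
  have "\<exists>Y. \<forall>n. (Y n p = x0 \<and> solves A f (I n) (Y n)) \<and> (\<forall>t\<in>I n. Y (Suc n) t = Y n t)"
  proof (rule dependent_nat_choice)
    show "\<exists>y. y p = x0 \<and> solves A f (I 0) y"
      by (intro exI[of _ "\<lambda>_. x0"]) (simp add: I_def solves_singleton[of A f p, simplified])
  qed (use ext in blast)
  then obtain Y where Y: "\<And>n. Y n p = x0" "\<And>n. solves A f (I n) (Y n)"
    "\<And>n t. t \<in> I n \<Longrightarrow> Y (Suc n) t = Y n t" by blast
  have Y_le: "Y n t = Y m t" if "m \<le> n" "t \<in> I m" for m n t
    using that(1)
  proof (induction rule: dec_induct)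
    case (step k)
    then have "t \<in> I k" using that(2) by (auto simp: I_def)
    then show ?case using Y(3) step by simp
  qed simp
  \<comment> \<open>An index whose interval contains \<open>t\<close>; by compatibility every other
    such index gives the same value.\<close>
  define N where "N t = nat \<lceil>\<bar>t - p\<bar>\<rceil>" for t
  have N: "t \<in> I (N t)" for t
    using real_nat_ceiling_ge[of "\<bar>t - p\<bar>"] unfolding I_def N_def atLeastAtMost_iff by linarith
  define y where "y t = Y (N t) t" for t
  have y: "y t = Y n t" if "t \<in> I n" for n t
    using Y_le[of n "N t" t] Y_le[of "N t" n t] that N[of t] unfolding y_def by (cases "n \<le> N t") auto
  have "solves A f UNIV y"
    unfolding solves_def kprim_def
  proof (intro ballI impI)
    fix s t :: real
    assume "s \<le> t"
    define n where "n = max (N s) (N t)"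
    have st: "s \<in> I n" "t \<in> I n"
      using N[of s] N[of t] by (auto simp: I_def n_def)
    have "kprim (stieltjes A y) (I n) (\<lambda>t. y t - f t)"
    proof (rule kprim_cong[OF Y(2)[of n, unfolded solves_def]])
      fix s s' r u v
      assume "s \<in> I n" "s' \<in> I n" "s \<le> u" "u \<le> r" "r \<le> v" "v \<le> s'"
      then have "r \<in> I n" by (auto simp: I_def)
      then show "stieltjes A y r u v = stieltjes A (Y n) r u v" by (simp add: stieltjes_def y)
    qed (simp add: y)
    then show "has_kint (stieltjes A y) s t (y t - f t - (y s - f s))"
      using st \<open>s \<le> t\<close> unfolding kprim_def by blast
  qed
  moreover have "y p = x0" using y[of p 0] Y(1) by (simp add: I_def)
  ultimately show ?thesis by blast
qed

section \<open>Periodic solutions\<close>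

lemma solves_zero_iff: "solves A (\<lambda>_. 0) S z \<longleftrightarrow> kprim (stieltjes A z) S z"
  by (simp add: solves_def)

text \<open>This gives content to the definite description: the columns exist and are unique as
  solutions of initial value problems with the standard basis vectors.\<close>

lemma is_transition_matrix_transition_matrix:
  fixes A :: "real \<Rightarrow> real^'n^'n"
  assumes V: "bv_by A V" and J: "jumps_invertible A"
  shows "is_transition_matrix A (transition_matrix A)"
  unfolding transition_matrix_def
proof (rule theI'[of "is_transition_matrix A"])
  have "\<exists>u. u s = axis j 1 \<and> solves A (\<lambda>_. 0) UNIV u" for s and j :: 'n
    by (rule solves_UNIV_exists[OF V J regulated_on_const])
  then obtain u where u: "\<And>s j. u s j s = axis j 1" "\<And>s j. solves A (\<lambda>_. 0) UNIV (u s j)" by metis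
  define U where "U t s = (\<chi> i j. u s j t $ i)" for t s
  have c: "column j (U t s) = u s j t" for t s j by (simp add: U_def column_def vec_eq_iff)
  show "\<exists>!U. is_transition_matrix A U"
  proof (rule ex1I)
    show "is_transition_matrix A U"
      unfolding is_transition_matrix_iff
      using u by (simp add: c matrix_eq_columns column_mat_1 solves_zero_iff)
  next
    fix W
    assume W: "is_transition_matrix A W"
    have "(\<lambda>r. column j (W r s)) = u s j" for s j
      by (rule solves_unique[OF V J _ u(2), of _ s])
        (use W u(1) in \<open>simp_all add: is_transition_matrix_iff solves_zero_iff column_mat_1\<close>)
    then have "column j (W t s) = column j (U t s)" for t s j by (metis c)
    then show "W = U" by (intro ext) (simp add: matrix_eq_columns)
  qed
qed

lemma fundamental_matrix_0:
  fixes A :: "real \<Rightarrow> real^'n^'n"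
  assumes "bv_by A V" "jumps_invertible A"
  shows "fundamental_matrix A 0 = mat 1"
  using is_transition_matrix_transition_matrix[OF assms]
  by (simp add: is_transition_matrix_iff fundamental_matrix_def)

lemma solves_fundamental_matrix:
  fixes A :: "real \<Rightarrow> real^'n^'n"
  assumes "bv_by A V" "jumps_invertible A"
  shows "solves A (\<lambda>_. 0) UNIV (\<lambda>t. fundamental_matrix A t *v v)"
proof -
  have "kprim (stieltjes A (\<lambda>t. column j (fundamental_matrix A t))) UNIV
      (\<lambda>t. column j (fundamental_matrix A t))" for j
    using is_transition_matrix_transition_matrix[OF assms]
    by (simp add: is_transition_matrix_iff fundamental_matrix_def)
  then show ?thesis
    unfolding solves_zero_iff matrix_mult_sum scalar_mult_eq_scaleR
    by (intro kprim_stieltjes_sum kprim_stieltjes_scaleR)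
qed

lemma homogeneous_solution_eq:
  fixes A :: "real \<Rightarrow> real^'n^'n"
  assumes "bv_by A V" "jumps_invertible A" "solves A (\<lambda>_. 0) UNIV z"
  shows "z t = fundamental_matrix A t *v z 0"
proof -
  have "z = (\<lambda>t. fundamental_matrix A t *v z 0)"
    by (rule solves_unique[OF assms solves_fundamental_matrix[OF assms(1,2)], of 0])
      (simp add: fundamental_matrix_0[OF assms(1,2)])
  then show ?thesis by metis
qed

lemma invertible_if_injective:
  fixes M :: "real^'n^'n"
  assumes "\<And>v. M *v v = 0 \<Longrightarrow> v = 0"
  shows "invertible M"
  by (metis assms invertible_left_inverse matrix_left_invertible_ker)

text \<open>A kernel vector at time \<open>s\<close> starts a homogeneous solution that vanishes at
  \<open>s\<close>, hence everywhere, in particular at 0, where its value is the vector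
  itself.\<close>

lemma invertible_fundamental_matrix:
  fixes A :: "real \<Rightarrow> real^'n^'n"
  assumes "bv_by A V" "jumps_invertible A"
  shows "invertible (fundamental_matrix A s)"
proof (rule invertible_if_injective)
  fix v
  assume "fundamental_matrix A s *v v = 0"
  from homogeneous_unique[OF assms solves_fundamental_matrix[OF assms, unfolded solves_zero_iff] this, of 0]
  show "v = 0" by (simp add: fundamental_matrix_0[OF assms])
qed

section \<open>Dichotomy and periodicity\<close>

lemma matrix_inv_left: "invertible M \<Longrightarrow> matrix_inv M ** M = mat 1"
  unfolding matrix_inv_def invertible_def by (rule someI2_ex) auto

lemma zero_if_norm_le_exp:
  fixes v :: "'a::real_normed_vector"
  assumes "\<And>k::nat. norm v \<le> K * exp (- a * real k) * c" and "a > 0"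
  shows "v = 0"
proof -
  have "(\<lambda>k. exp (- a) ^ k) \<longlonglongrightarrow> (0::real)"
    using \<open>a > 0\<close> by (intro LIMSEQ_realpow_zero) auto
  then have "(\<lambda>k. K * exp (- a) ^ k * c) \<longlonglongrightarrow> K * 0 * c"
    by (intro tendsto_mult tendsto_const)
  moreover have "exp (- a) ^ k = exp (- a * real k)" for k
    using exp_of_nat_mult[of k "- a"] by (simp add: mult.commute)
  ultimately have "(\<lambda>k. K * exp (- a * real k) * c) \<longlonglongrightarrow> 0" by simp
  then have "norm v \<le> 0" by (rule LIMSEQ_le_const) (use assms(1) in blast)
  then show ?thesis by simp
qed

lemma periodic_homogeneous_zero:
  fixes A :: "real \<Rightarrow> real^'n^'n"
  assumes V: "bv_by A V" and J: "jumps_invertible A" and D: "exponential_dichotomy A"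
    and z: "solves A (\<lambda>_. 0) UNIV z" and "\<omega> > 0" and per: "\<And>t. z (t + \<omega>) = z t"
  shows "z 0 = 0"
proof -
  let ?\<Phi> = "fundamental_matrix A"
  define v where "v = z 0"
  have shift: "z (t + real k * \<omega>) = z t" for t k
  proof (induction k)
    case (Suc k)
    then show ?case using per[of "t + real k * \<omega>"] by (simp add: algebra_simps)
  qed simp
  have pos: "z (real k * \<omega>) = v" and neg: "z (- (real k * \<omega>)) = v" for k
    using shift[of 0 k] shift[of "- (real k * \<omega>)" k] by (simp_all add: v_def)
  \<comment> \<open>At a time where the solution has returned to \<open>v\<close>, the fundamental
    matrix fixes \<open>v\<close>, and so does its inverse.\<close>
  have inv: "matrix_inv (?\<Phi> s) *v v = v" if "z s = v" for s
  proof -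
    have "v = ?\<Phi> s *v v" using homogeneous_solution_eq[OF V J z, of s] that by (simp add: v_def)
    then have "matrix_inv (?\<Phi> s) *v v = (matrix_inv (?\<Phi> s) ** ?\<Phi> s) *v v"
      by (simp flip: matrix_vector_mul_assoc)
    then show ?thesis
      by (simp add: matrix_inv_left invertible_fundamental_matrix[OF V J])
  qed
  have norm_le: "norm (Q *v v) \<le> op_norm (?\<Phi> 0 ** Q ** matrix_inv (?\<Phi> s)) * norm v"
    if "z s = v" for Q s
    using norm_matrix_vector_le_op_norm[of "?\<Phi> 0 ** Q ** matrix_inv (?\<Phi> s)" v] inv[OF that]
    by (simp add: fundamental_matrix_0[OF V J] flip: matrix_vector_mul_assoc)
  obtain K \<alpha> P where "\<alpha> > 0"
    and st: "\<And>t s. s \<le> t \<Longrightarrow> op_norm (?\<Phi> t ** P ** matrix_inv (?\<Phi> s)) \<le> K * exp (- \<alpha> * (t - s))"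
    and un: "\<And>t s. t \<le> s \<Longrightarrow>
      op_norm (?\<Phi> t ** (mat 1 - P) ** matrix_inv (?\<Phi> s)) \<le> K * exp (- \<alpha> * (s - t))"
    using D unfolding exponential_dichotomy_def by blast
  \<comment> \<open>The part \<open>P v\<close> is compared with the past time
    \<open>- k * \<omega>\<close>, the complementary part with the future time
    \<open>k * \<omega>\<close>. Both are at distance \<open>k * \<omega>\<close> from 0, which
    gives the decay rate \<open>\<alpha> * \<omega>\<close> per step.\<close>
  have "P *v v = 0"
  proof (rule zero_if_norm_le_exp)
    fix k :: nat
    show "norm (P *v v) \<le> K * exp (- (\<alpha> * \<omega>) * real k) * norm v"
      using norm_le[OF neg, of P k] mult_right_mono[OF st[of "- (real k * \<omega>)" 0], of "norm v"] \<open>\<omega> > 0\<close>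
      by (simp add: mult_ac)
  qed (use \<open>\<alpha> > 0\<close> \<open>\<omega> > 0\<close> in simp)
  moreover have "(mat 1 - P) *v v = 0"
  proof (rule zero_if_norm_le_exp)
    fix k :: nat
    show "norm ((mat 1 - P) *v v) \<le> K * exp (- (\<alpha> * \<omega>) * real k) * norm v"
      using norm_le[OF pos, of "mat 1 - P" k] mult_right_mono[OF un[of 0 "real k * \<omega>"], of "norm v"] \<open>\<omega> > 0\<close>
      by (simp add: mult_ac)
  qed (use \<open>\<alpha> > 0\<close> \<open>\<omega> > 0\<close> in simp)
  ultimately show ?thesis by (simp add: matrix_vector_mult_diff_rdistrib v_def)
qed

text \<open>Only increments of \<open>A\<close> enter a Stieltjes sum, and the constant
  \<open>C\<close> cancels in them.\<close>

lemma solves_shift: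
  fixes A :: "real \<Rightarrow> real^'n^'n"
  assumes "\<And>t. A (t + \<omega>) - A t = C" "\<And>t. f (t + \<omega>) = f t" "solves A f UNIV y"
  shows "solves A f UNIV (\<lambda>t. y (t + \<omega>))"
  unfolding solves_def kprim_def
proof (intro ballI impI)
  fix s t :: real
  assume "s \<le> t"
  then have "has_kint (stieltjes A y) (s + \<omega>) (t + \<omega>) (y (t + \<omega>) - f (t + \<omega>) - (y (s + \<omega>) - f (s + \<omega>)))"
    using assms(3) unfolding solves_def kprim_def by simp
  from has_kint_shift[OF this]
  show "has_kint (stieltjes A (\<lambda>t. y (t + \<omega>))) s t (y (t + \<omega>) - f t - (y (s + \<omega>) - f s))"
    unfolding assms(2)
  proof (rule has_kint_cong)
    fix r u v
    have "A (v + \<omega>) - A (u + \<omega>) = A v - A u"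
      using assms(1)[of u] assms(1)[of v] by (simp add: algebra_simps)
    then show "stieltjes A y (r + \<omega>) (u + \<omega>) (v + \<omega>) = stieltjes A (\<lambda>t. y (t + \<omega>)) r u v"
      by (simp add: stieltjes_def)
  qed
qed

theorem proposition4p2:
  fixes A :: "real \<Rightarrow> real^'n^'n" and C :: "real^'n^'n"
    and f :: "real \<Rightarrow> real^'n" and \<omega> :: real
  assumes "locally_bounded_variation A"
    and "\<omega> > 0"
    and "\<forall>t. A (t + \<omega>) - A t = C"
    and "\<forall>a b. a \<le> b \<longrightarrow> regulated_on a b f"
    and "\<forall>t. f (t + \<omega>) = f t"
    and "\<forall>t. invertible (mat 1 - left_jump A t)"
    and "\<forall>t. invertible (mat 1 + right_jump A t)"
    and "exponential_dichotomy A"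
  shows "\<exists>!x. glde_solution A f x \<and> (\<forall>t. x (t + \<omega>) = x t)"
proof -
  obtain V where V: "bv_by A V" using bv_by_exists[OF assms(1)] by blast
  have J: "jumps_invertible A" using assms(6,7) by (simp add: jumps_invertible_def)
  have f: "regulated_on a b f" for a b
    using assms(4) by (cases "a \<le> b") (auto simp: regulated_on_def)
  let ?\<Phi> = "fundamental_matrix A"
  note hom = solves_fundamental_matrix[OF V J]
  note \<Phi>0 = fundamental_matrix_0[OF V J]
  note zero = periodic_homogeneous_zero[OF V J assms(8) _ assms(2)]
  \<comment> \<open>The translate by \<omega> solves the same equation and agrees with
    \<open>y\<close> at 0, so uniqueness identifies the two. The forcing \<open>g\<close> is left
    general to cover both \<open>f\<close> and 0.\<close>
  have periodic: "\<forall>t. y (t + \<omega>) = y t"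
    if "solves A g UNIV y" "\<And>t. g (t + \<omega>) = g t" "y \<omega> = y 0" for g y
  proof -
    have "solves A g UNIV (\<lambda>t. y (t + \<omega>))"
      using solves_shift[of A \<omega> C g y] assms(3) that(1,2) by blast
    from solves_unique[OF V J this that(1), of 0] have "(\<lambda>t. y (t + \<omega>)) = y" using that(3) by simp
    then show ?thesis by metis
  qed
  obtain y0 where y0: "y0 0 = 0" "solves A f UNIV y0"
    using solves_UNIV_exists[OF V J f] by blast
  have "invertible (mat 1 - ?\<Phi> \<omega>)"
  proof (rule invertible_if_injective)
    fix v
    assume "(mat 1 - ?\<Phi> \<omega>) *v v = 0"
    then have "?\<Phi> \<omega> *v v = ?\<Phi> 0 *v v" by (simp add: \<Phi>0 matrix_vector_mult_diff_rdistrib)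
    from zero[OF hom] periodic[OF hom _ this] show "v = 0" by (simp add: \<Phi>0)
  qed
  \<comment> \<open>The solution with initial value \<open>v\<close> is
    \<open>y0 t + ?\<Phi> t *v v\<close>, so returning at time \<omega> means that \<open>v\<close>
    is a fixed point of the affine map sending \<open>v\<close> to
    \<open>y0 \<omega> + ?\<Phi> \<omega> *v v\<close>.\<close>
  then obtain v where "(mat 1 - ?\<Phi> \<omega>) *v v = y0 \<omega>" using invertible_mult_surj by blast
  then have v: "y0 \<omega> + ?\<Phi> \<omega> *v v = v" by (simp add: matrix_vector_mult_diff_rdistrib algebra_simps)
  define x where "x t = y0 t + ?\<Phi> t *v v" for t
  have x: "solves A f UNIV x"
    using kprim_stieltjes_add[OF y0(2)[unfolded solves_def] hom[unfolded solves_zero_iff]]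
    by (simp add: solves_def x_def[abs_def] algebra_simps)
  have "x \<omega> = x 0" using v y0(1) by (simp add: x_def \<Phi>0)
  then have "\<forall>t. x (t + \<omega>) = x t" using periodic[OF x] assms(5) by simp
  \<comment> \<open>The difference of two periodic solutions is a periodic homogeneous solution; it
    vanishes at 0, and then uniqueness of the initial value problem applies.\<close>
  moreover have "y = x" if y: "solves A f UNIV y" "\<forall>t. y (t + \<omega>) = y t" for y
  proof -
    have "solves A (\<lambda>_. 0) UNIV (\<lambda>t. y t - x t)"
      using kprim_stieltjes_diff[OF y(1)[unfolded solves_def] x[unfolded solves_def]]
      by (simp add: solves_def)
    from zero[OF this] have "y 0 - x 0 = 0"
      using y(2) \<open>\<forall>t. x (t + \<omega>) = x t\<close> by simp
    then show ?thesis using solves_unique[OF V J y(1) x, of 0] by simp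
  qed
  ultimately show ?thesis
    unfolding glde_solution_iff solves_def[symmetric] using x by blast
qed

end
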